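(* Fix $h>0$, $a\geqslant0$ and an integer $N\geqslant0$. With $X$, $X_{n,k}$, $P_n$ as below, set \[ A(h)=\frac{h}{2\pi}\Bigl(X+\sum_{n=0}^\infty\frac{1}{2^n}\sum_{k=1}^{P_n}X_{n,k}\Bigr),\qquad A_N(h)=\frac{h}{2\pi}\Bigl(X+\sum_{n=0}^N\frac{1}{2^n}\sum_{k=1}^{P_n}X_{n,k}\Bigr). \] Then \[ \mathbb E\,\bigl|A(h)-A_N(h)\bigr|^2=\frac{a^2}{3\cdot2^{N+1}}\Bigl(\frac h2\Bigr)^2 . \] Moreover, writing $\sigma_N=\frac{a}{\sqrt{3\cdot2^{N+1}}}\,\frac h2$, there exists (on a suitable extension of the probability space) a standard Normal random variable $Z$, independent of $A_N(h)$, such that \[ \mathbb E\,\bigl|A(h)-\bigl(A_N(h)+\sigma_N Z\bigr)\bigr|^2\leqslant\frac{8}{15}\,\frac{1}{2^{2N+2}}\Bigl(\frac h2\Bigr)^2 . \]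
   Context: $X$ and $X_{n,k}$ ($n\geqslant0$, $k\geqslant1$) are i.i.d. standard Logistic random variables (density $e^{-x}/(1+e^{-x})^2$, mean $0$, variance $\pi^2/3$); $P_n\sim\mathsf{Poisson}(\tfrac12a^22^n)$ for $n\geqslant0$; all are mutually independent. Empty sums are $0$. By the logistic expansion, $A(h)$ has the conditional distribution of the Lévy area of a two-dimensional Wiener process over a time step $h$ given the increments, with $a^2=((\Delta W^1(h))^2+(\Delta W^2(h))^2)/h$. *)

theory Defs
  imports "HOL-Probability.Probability"
begin

definition logistic_density :: "real \<Rightarrow> real" where
  "logistic_density x = exp (- x) / (1 + exp (- x))^2"

text \<open>Poisson probability mass function with mean lam (lam = 0 gives the point mass at 0).\<close>
definition poisson_mass :: "real \<Rightarrow> nat \<Rightarrow> real" where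
  "poisson_mass lam k = lam ^ k / fact k * exp (- lam)"

definition levy_A :: "real \<Rightarrow> ('a \<Rightarrow> real) \<Rightarrow> (nat \<Rightarrow> nat \<Rightarrow> 'a \<Rightarrow> real) \<Rightarrow> (nat \<Rightarrow> 'a \<Rightarrow> nat) \<Rightarrow> 'a \<Rightarrow> real" where
  "levy_A h X Y P \<omega> = h / (2 * pi) *
     (X \<omega> + (\<Sum>n. (1 / 2 ^ n) * (\<Sum>k = 1..P n \<omega>. Y n k \<omega>)))"

definition levy_A_N :: "real \<Rightarrow> nat \<Rightarrow> ('a \<Rightarrow> real) \<Rightarrow> (nat \<Rightarrow> nat \<Rightarrow> 'a \<Rightarrow> real) \<Rightarrow> (nat \<Rightarrow> 'a \<Rightarrow> nat) \<Rightarrow> 'a \<Rightarrow> real" where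
  "levy_A_N h N X Y P \<omega> = h / (2 * pi) *
     (X \<omega> + (\<Sum>n = 0..N. (1 / 2 ^ n) * (\<Sum>k = 1..P n \<omega>. Y n k \<omega>)))"

text \<open>Index set for the independent family: X, the X_{n,k} (k \<ge> 1), and the P_n.\<close>
datatype rv_idx = IX | IY nat nat | IP nat

end

theory Submission
  imports Defs "HOL-Real_Asymp.Real_Asymp"
begin

text \<open>
  A standard logistic variable is a Gaussian scale mixture: it has the law of $\sqrt V\,Z$ with $Z$
  standard normal and independent of $V = \sum_k 2E_k/k^2$, where the $E_k$ are i.i.d. standard
  exponential. This is Euler's product for
  $\Gamma(1 - it)\,\Gamma(1 + it) = \prod_k (1 + t^2/k^2)^{-1}$, the characteristic function of the
  logistic law. Comparing characteristic functions, the rescaled tail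
  $T = \sum_{n>N} 2^{-n} \sum_{k \le P_n} X_{n,k}$ therefore has the law of $\sqrt S\,Z$ with
  $S = \sum_{n>N} 4^{-n} \sum_{k \le P_n} V_{n,k}$. Coupling $T$ with $Z$ in this way costs
  $E(\sqrt S - \sqrt m)^2 \le \mathrm{Var}(S)/m$, where $m = E S = E T^2$, and
  $E V^2 \le 2 (E V)^2$ already yields the constant $8/21 \le 8/15$. The coupling lives on an extension of
  the given space on which $S$ is sampled from its posterior law given $T$ and $Z = T/\sqrt S$.
\<close>

section \<open>Gaussian scale mixtures and the logistic distribution\<close>

text \<open>Scale mixtures suit this series because they add up: independent variables of law sqrt V
  Z, summed with weights 2^-n, have as conditional variance the sum of the V with weights 4^-n. The
  series is therefore studied once, for an arbitrary jump law \<open>D\<close> and ratio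
  \<open>r\<close>, and used twice: logistic jumps with r = 1/2 for T, jumps of the law of V with r
  = 1/4 for S. Exponents z with Re z * x <= 0 cover both the Fourier transform of T and the Laplace
  transform of S. The final bound is free of a because the intensities enter Var S and m with the
  same factor a^2/2. Its decay is explained likewise: Var S sums 16^-n 2^n = 8^-n, while m sums 4^-n
  2^n = 2^-n, so the ratio is of order 4^-N. The factor 2 in the estimate of E V^2 is the second
  moment of a standard exponential. Since Z is a quotient by sqrt S, almost sure positivity of S is
  essential. It holds exactly when a > 0, so a = 0 is treated apart. Z is independent of A_N(h)
  because the added randomness depends on the given space only through T, which is independent of
  A_N(h).\<close>

definition gauss_mixture :: "real measure \<Rightarrow> real measure" where
  "gauss_mixture \<mu> = distr (\<mu> \<Otimes>\<^sub>M std_normal_distribution) borel (\<lambda>(s, z). sqrt s * z)"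

lemma real_distribution_gauss_mixture:
  assumes "real_distribution \<mu>"
  shows "real_distribution (gauss_mixture \<mu>)"
proof -
  interpret mu: real_distribution \<mu> by fact
  interpret N: real_distribution std_normal_distribution by (rule real_dist_normal_dist)
  interpret pair_prob_space \<mu> std_normal_distribution ..
  show ?thesis unfolding gauss_mixture_def
    by (rule real_distribution_distr) simp
qed

text \<open>Given the scale s, the variable is centred normal with variance s, so the characteristic
  function at t is the Laplace transform of \<open>\<mu>\<close> at t^2/2. Nonnegativity matters
  because the real \<open>sqrt\<close> is odd: for negative s the square would produce |s|.\<close>

lemma char_gauss_mixture:
  assumes "real_distribution \<mu>" and nn: "AE s in \<mu>. 0 \<le> s"
  shows "char (gauss_mixture \<mu>) t = (\<integral>s. exp (of_real (- (t\<^sup>2 * s / 2))) \<partial>\<mu>)"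
proof -
  interpret mu: real_distribution \<mu> by fact
  interpret N: real_distribution std_normal_distribution by (rule real_dist_normal_dist)
  interpret PP: pair_prob_space \<mu> std_normal_distribution ..
  have "char (gauss_mixture \<mu>) t = (\<integral>p. iexp (t * (sqrt (fst p) * snd p)) \<partial>(\<mu> \<Otimes>\<^sub>M std_normal_distribution))"
    unfolding char_def gauss_mixture_def by (subst integral_distr) (auto simp: case_prod_unfold)
  also have "\<dots> = (\<integral>s. \<integral>z. iexp (t * (sqrt s * z)) \<partial>std_normal_distribution \<partial>\<mu>)"
    by (subst PP.integral_fst'[symmetric]) (auto intro!: PP.integrable_const_bound[where B=1])
  also have "\<dots> = (\<integral>s. char std_normal_distribution (t * sqrt s) \<partial>\<mu>)"
    unfolding char_def by (simp add: mult.assoc)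
  also have "\<dots> = (\<integral>s. exp (of_real (- (t\<^sup>2 * s / 2))) \<partial>\<mu>)"
  proof (rule integral_cong_AE)
    show "AE s in \<mu>. char std_normal_distribution (t * sqrt s) = exp (of_real (- (t\<^sup>2 * s / 2)))"
      using nn
    proof eventually_elim
      case (elim s)
      then have "(t * sqrt s)\<^sup>2 = t\<^sup>2 * s" by (simp add: power_mult_distrib)
      then show ?case unfolding char_std_normal_distribution exp_of_real by simp
    qed
  qed auto
  finally show ?thesis .
qed

lemma std_normal_integrals:
  "(\<integral>\<^sup>+z. ennreal (z\<^sup>2) \<partial>std_normal_distribution) = 1"
  "(\<integral>z. z \<partial>std_normal_distribution) = 0"
  using std_normal_distribution_even_moments(1)[of 1] std_normal_distribution_even_moments(2)[of 1]
    integral_std_normal_distribution_moment_odd[of 1]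
  by (auto simp: nn_integral_eq_integral)

text \<open>Tonelli in \<open>ennreal\<close> gives the second moment together with its finiteness;
  the mean vanishes because the inner normal integral does.\<close>

lemma gauss_mixture_moments:
  assumes "real_distribution \<mu>" and nn: "AE s in \<mu>. 0 \<le> s" and int: "integrable \<mu> (\<lambda>s. s)"
  shows "integrable (gauss_mixture \<mu>) (\<lambda>x. x\<^sup>2)"
    and "(\<integral>x. x\<^sup>2 \<partial>gauss_mixture \<mu>) = (\<integral>s. s \<partial>\<mu>)"
    and "(\<integral>x. x \<partial>gauss_mixture \<mu>) = 0"
proof -
  interpret mu: real_distribution \<mu> by fact
  interpret N: real_distribution std_normal_distribution by (rule real_dist_normal_dist)
  interpret PP: pair_prob_space \<mu> std_normal_distribution ..
  interpret G: real_distribution "gauss_mixture \<mu>"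
    by (rule real_distribution_gauss_mixture) fact
  have "(\<integral>\<^sup>+x. ennreal (x\<^sup>2) \<partial>gauss_mixture \<mu>)
      = (\<integral>\<^sup>+p. ennreal ((sqrt (fst p) * snd p)\<^sup>2) \<partial>(\<mu> \<Otimes>\<^sub>M std_normal_distribution))"
    unfolding gauss_mixture_def by (subst nn_integral_distr) (auto simp: case_prod_unfold)
  also have "\<dots> = (\<integral>\<^sup>+s. \<integral>\<^sup>+z. ennreal ((sqrt s * z)\<^sup>2) \<partial>std_normal_distribution \<partial>\<mu>)"
    by (subst N.nn_integral_fst[symmetric]) auto
  also have "\<dots> = (\<integral>\<^sup>+s. ennreal ((sqrt s)\<^sup>2) * (\<integral>\<^sup>+z. ennreal (z\<^sup>2) \<partial>std_normal_distribution) \<partial>\<mu>)"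
    by (subst nn_integral_cmult[symmetric]) (auto simp: power_mult_distrib ennreal_mult)
  also have "\<dots> = (\<integral>\<^sup>+s. ennreal s \<partial>\<mu>)"
    using nn by (intro nn_integral_cong_AE) (auto simp: std_normal_integrals)
  also have "\<dots> = ennreal (\<integral>s. s \<partial>\<mu>)"
    by (rule nn_integral_eq_integral[OF int nn])
  finally have eq: "(\<integral>\<^sup>+x. ennreal (x\<^sup>2) \<partial>gauss_mixture \<mu>) = ennreal (\<integral>s. s \<partial>\<mu>)" .
  have pos: "0 \<le> (\<integral>s. s \<partial>\<mu>)" by (rule integral_nonneg_AE[OF nn])
  show i2: "integrable (gauss_mixture \<mu>) (\<lambda>x. x\<^sup>2)"
    by (rule integrableI_nonneg) (auto simp: eq)
  show "(\<integral>x. x\<^sup>2 \<partial>gauss_mixture \<mu>) = (\<integral>s. s \<partial>\<mu>)"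
    using pos eq by (subst integral_eq_nn_integral) auto
  have i1: "integrable (gauss_mixture \<mu>) (\<lambda>x. x)"
    by (rule G.square_integrable_imp_integrable[OF _ i2]) simp
  have "(\<integral>x. x \<partial>gauss_mixture \<mu>) = (\<integral>p. sqrt (fst p) * snd p \<partial>(\<mu> \<Otimes>\<^sub>M std_normal_distribution))"
    unfolding gauss_mixture_def by (subst integral_distr) (auto simp: case_prod_unfold)
  also have "\<dots> = (\<integral>s. \<integral>z. sqrt s * z \<partial>std_normal_distribution \<partial>\<mu>)"
    using i1 unfolding gauss_mixture_def
    by (subst PP.integral_fst'[symmetric]) (auto simp: integrable_distr_eq case_prod_unfold)
  finally show "(\<integral>x. x \<partial>gauss_mixture \<mu>) = 0" by (simp add: std_normal_integrals)
qed

section \<open>The logistic law and its characteristic function\<close>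

definition logistic_distribution :: "real measure" where
  "logistic_distribution = density lborel (\<lambda>x. ennreal (logistic_density x))"

abbreviation exp_distribution :: "real measure" where
  "exp_distribution \<equiv> density lborel (\<lambda>x. ennreal (exponential_density 1 x))"

lemma real_distribution_exp_distribution: "real_distribution exp_distribution"
  using prob_space_exponential_density[of 1] by (auto simp: real_distribution_def real_distribution_axioms_def)

lemma AE_exp_distribution_pos: "AE x in exp_distribution. 0 < x"
proof -
  have "AE x::real in lborel. x \<noteq> 0"
    by (rule AE_lborel_singleton)
  then show ?thesis
    by (subst AE_density) (auto simp: exponential_density_def elim!: eventually_mono)
qed

lemma emeasure_exp_distribution_greaterThan:
  assumes "0 \<le> a"
  shows "emeasure exp_distribution {a<..} = ennreal (exp (- a))"
proof -
  interpret E: real_distribution exp_distribution by (rule real_distribution_exp_distribution)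
  have "distributed exp_distribution lborel (\<lambda>x. x) (exponential_density 1)"
    unfolding distributed_def by (auto simp: distr_id2)
  from E.exponential_distributedD_gt[OF this assms]
  have "measure exp_distribution {x. a < x} = exp (- a)" by simp
  then show ?thesis by (simp add: E.emeasure_eq_measure greaterThan_def)
qed

lemma logistic_density_measurable [measurable]: "logistic_density \<in> borel_measurable borel"
  unfolding logistic_density_def[abs_def] by measurable

lemma emeasure_logistic_distribution_greaterThan:
  "emeasure logistic_distribution {x<..} = ennreal (1 / (1 + exp x))"
proof -
  have d: "((\<lambda>x. 1 / (1 + exp (- x))) has_real_derivative logistic_density y) (at y)" for y
  proof -
    have "1 + exp (- y) \<noteq> 0" by (smt (verit) exp_gt_zero)
    then show ?thesis unfolding logistic_density_def
      by (auto intro!: derivative_eq_intros simp: power2_eq_square)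
  qed
  have "emeasure logistic_distribution {x<..}
      = (\<integral>\<^sup>+y. ennreal (logistic_density y) * indicator {x<..} y \<partial>lborel)"
    unfolding logistic_distribution_def by (subst emeasure_density) auto
  also have "\<dots> = (\<integral>\<^sup>+y. ennreal (logistic_density y) * indicator {x..} y \<partial>lborel)"
    using AE_lborel_singleton[of x]
    by (intro nn_integral_cong_AE) (auto elim!: eventually_mono split: split_indicator)
  also have "\<dots> = 1 - 1 / (1 + exp (- x))"
  proof (rule nn_integral_FTC_atLeast)
    show "((\<lambda>x::real. 1 / (1 + exp (- x))) \<longlongrightarrow> 1) at_top" by real_asymp
  qed (auto simp: d, simp add: logistic_density_def)
  also have "1 - 1 / (1 + exp (- x)) = 1 / (1 + exp x)"
  proof -
    have "1 + exp x \<noteq> 0" "exp x \<noteq> 0" by (smt (verit) exp_gt_zero)+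
    then show ?thesis by (simp add: exp_minus divide_simps)
  qed
  finally show ?thesis .
qed

text \<open>With c = exp x, P(ln U - ln V > x) = P(U > c V) = E exp(- c V) = 1 / (1 + c), the
  logistic tail. This representation turns the characteristic function into Mellin integrals of the
  exponential density, that is, into values of Gamma.\<close>

lemma logistic_distribution_eq_distr_ln_quotient:
  "logistic_distribution
     = distr (exp_distribution \<Otimes>\<^sub>M exp_distribution) borel (\<lambda>(v, u). ln u - ln v)"
proof (rule measure_eqI_lessThan)
  interpret E: real_distribution exp_distribution by (rule real_distribution_exp_distribution)
  show "emeasure logistic_distribution {x<..} < \<infinity>" for x
    by (simp add: emeasure_logistic_distribution_greaterThan)
  fix x :: real
  define c where "c = exp x"
  have c: "c > 0" by (simp add: c_def)
  have "emeasure (distr (exp_distribution \<Otimes>\<^sub>M exp_distribution) borel (\<lambda>(v, u). ln u - ln v)) {x<..}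
    = (\<integral>\<^sup>+p. indicator {x<..} (ln (snd p) - ln (fst p)) \<partial>(exp_distribution \<Otimes>\<^sub>M exp_distribution))"
    by (subst nn_integral_indicator[symmetric], simp, subst nn_integral_distr) (simp_all add: case_prod_unfold)
  also have "\<dots> = (\<integral>\<^sup>+v. \<integral>\<^sup>+u. indicator {x<..} (ln u - ln v) \<partial>exp_distribution \<partial>exp_distribution)"
    by (subst E.nn_integral_fst[symmetric]) auto
  also have "\<dots> = (\<integral>\<^sup>+v. ennreal (exp (- c * v)) \<partial>exp_distribution)"
  proof (rule nn_integral_cong_AE, rule AE_mp[OF AE_exp_distribution_pos], rule AE_I2, rule impI)
    fix v :: real assume v: "v > 0"
    have "(\<integral>\<^sup>+u. indicator {x<..} (ln u - ln v) \<partial>exp_distribution)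
      = (\<integral>\<^sup>+u. indicator {c * v<..} u \<partial>exp_distribution)"
    proof (rule nn_integral_cong_AE, rule AE_mp[OF AE_exp_distribution_pos], rule AE_I2, rule impI)
      fix u :: real assume u: "u > 0"
      have "x < ln u - ln v \<longleftrightarrow> exp (x + ln v) < exp (ln u)" by (simp only: exp_less_cancel_iff) auto
      also have "\<dots> \<longleftrightarrow> c * v < u" using u v by (simp add: c_def exp_add)
      finally show "indicator {x<..} (ln u - ln v) = (indicator {c * v<..} u :: ennreal)"
        by (simp add: indicator_def)
    qed
    also have "\<dots> = ennreal (exp (- c * v))"
      using v c by (simp add: emeasure_exp_distribution_greaterThan)
    finally show "(\<integral>\<^sup>+u. indicator {x<..} (ln u - ln v) \<partial>exp_distribution) = ennreal (exp (- c * v))" .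
  qed
  also have "\<dots> = (\<integral>\<^sup>+v. ennreal (exp (- (1 + c) * v)) * indicator {0..} v \<partial>lborel)"
    by (subst nn_integral_density)
       (auto intro!: nn_integral_cong simp: exponential_density_def ennreal_mult[symmetric]
         exp_add[symmetric] algebra_simps split: split_indicator)
  also have "\<dots> = 0 - (- exp (- (1 + c) * 0) / (1 + c))"
  proof (rule nn_integral_FTC_atLeast)
    show "((\<lambda>v. - exp (- (1 + c) * v) / (1 + c)) \<longlongrightarrow> 0) at_top"
      using c by real_asymp
    show "((\<lambda>v. - exp (- (1 + c) * v) / (1 + c)) has_real_derivative exp (- (1 + c) * v)) (at v)" for v
    proof -
      have "((\<lambda>v. - exp (- d * v) / d) has_real_derivative exp (- d * v)) (at v)" if "d \<noteq> 0" for d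
        using that by (auto intro!: derivative_eq_intros)
      from this[of "1 + c"] show ?thesis using c by simp
    qed
  qed auto
  finally show "emeasure logistic_distribution {x<..} = emeasure (distr (exp_distribution \<Otimes>\<^sub>M exp_distribution) borel (\<lambda>(v, u). ln u - ln v)) {x<..}"
    by (simp add: emeasure_logistic_distribution_greaterThan c_def)
qed (auto simp: logistic_distribution_def)

lemma real_distribution_logistic: "real_distribution logistic_distribution"
proof -
  interpret E: real_distribution exp_distribution by (rule real_distribution_exp_distribution)
  interpret PP: pair_prob_space exp_distribution exp_distribution ..
  show ?thesis unfolding logistic_distribution_eq_distr_ln_quotient
    by (rule PP.real_distribution_distr) simp
qed

text \<open>Since exp(i t ln u) = u^(i t), this is Euler's integral for Gamma.\<close>

lemma integral_exp_distribution_powr: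
  "(\<integral>u. iexp (t * ln u) \<partial>exp_distribution) = Gamma (1 + \<i> * of_real t)"
proof -
  let ?z = "1 + \<i> * complex_of_real t"
  let ?g = "\<lambda>u. exponential_density 1 u *\<^sub>R iexp (t * ln u)"
  have i: "integrable lborel ?g"
  proof -
    interpret E: real_distribution exp_distribution by (rule real_distribution_exp_distribution)
    have "integrable exp_distribution (\<lambda>u. iexp (t * ln u))"
      by (intro E.integrable_const_bound[where B=1]) auto
    then show ?thesis
      by (rule integrable_density[THEN iffD1, rotated -1]) (simp_all add: exponential_density_nonneg)
  qed
  have "(\<integral>u. iexp (t * ln u) \<partial>exp_distribution) = (\<integral>u. ?g u \<partial>lborel)"
    by (subst integral_density) (auto simp: exponential_density_nonneg)
  moreover have "(?g has_integral (\<integral>u. ?g u \<partial>lborel)) UNIV"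
    by (rule has_integral_integral_lborel[OF i])
  moreover have "(?g has_integral Gamma ?z) UNIV"
  proof -
    have "((\<lambda>u. of_real u powr (?z - 1) / of_real (exp u)) has_integral Gamma ?z) {0..}"
      by (rule Gamma_integral_complex) simp
    \<comment> \<open>The two integrands may disagree at u = 0, where \<open>ln\<close> and
      \<open>powr\<close> take default values; a single point does not affect the integral.\<close>
    then have "(?g has_integral Gamma ?z) {0..}"
      by (rule has_integral_spike_finite[where S="{0}", rotated 2])
         (auto simp: exponential_density_def powr_def Ln_of_real scaleR_conv_of_real exp_minus exp_of_real
           divide_inverse algebra_simps)
    then show ?thesis
      by (rule has_integral_on_superset) (auto simp: exponential_density_def)
  qed
  ultimately show ?thesis by (metis has_integral_unique)
qed


lemma char_logistic_distribution_eq: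
  "char logistic_distribution t = Gamma (1 - \<i> * of_real t) * Gamma (1 + \<i> * of_real t)"
proof -
  interpret E: real_distribution exp_distribution by (rule real_distribution_exp_distribution)
  interpret PP: pair_prob_space exp_distribution exp_distribution ..
  let ?EE = "exp_distribution \<Otimes>\<^sub>M exp_distribution"
  have m: "(\<lambda>(v, u). ln u - ln v) \<in> ?EE \<rightarrow>\<^sub>M borel" by simp
  have m2: "(\<lambda>p. iexp (t * (ln (snd p) - ln (fst p)))) \<in> borel_measurable ?EE" by simp
  have "char logistic_distribution t
     = (\<integral>p. iexp (t * (case p of (v, u) \<Rightarrow> ln u - ln v)) \<partial>?EE)"
    unfolding char_def logistic_distribution_eq_distr_ln_quotient
    by (rule integral_distr[OF m]) simp
  also have "\<dots> = (\<integral>p. iexp (t * (ln (snd p) - ln (fst p))) \<partial>?EE)"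
    by (simp only: case_prod_unfold)
  also have "\<dots> = (\<integral>v. \<integral>u. iexp (t * (ln u - ln v)) \<partial>exp_distribution \<partial>exp_distribution)"
  proof -
    have "integrable ?EE (\<lambda>p. iexp (t * (ln (snd p) - ln (fst p))))"
      by (rule PP.integrable_const_bound[where B=1, OF _ m2]) simp
    from PP.integral_fst'[OF this] show ?thesis by simp
  qed
  also have "\<dots> = (\<integral>v. \<integral>u. iexp (- t * ln v) * iexp (t * ln u) \<partial>exp_distribution \<partial>exp_distribution)"
    by (simp only: exp_add[symmetric] of_real_add[symmetric] of_real_mult[symmetric] distrib_left[symmetric])
       (simp add: right_diff_distrib)
  also have "\<dots> = Gamma (1 + \<i> * of_real (- t)) * Gamma (1 + \<i> * of_real t)"
    by (simp only: integral_mult_right_zero integral_mult_left_zero integral_exp_distribution_powr)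
  finally show ?thesis by simp
qed

text \<open>For z = i t, Gamma(1 - z) Gamma(1 + z) = z Gamma(z) Gamma(1 - z) = pi z / sin(pi z) by
  reflection, and Euler's product for the sine supplies the factors 1 + t^2/k^2. The case t = 0 is
  split off, since the quotient reads 0/0 there.\<close>

lemma char_logistic_distribution:
  "(\<lambda>n. \<Prod>k=1..n. 1 / (1 + complex_of_real (t\<^sup>2) / of_nat k ^ 2)) \<longlonglongrightarrow> char logistic_distribution t"
proof (cases "t = 0")
  case True
  then show ?thesis by (simp add: char_logistic_distribution_eq)
next
  case False
  define z where "z = \<i> * complex_of_real t"
  have z2: "z\<^sup>2 = - complex_of_real (t\<^sup>2)" by (simp add: z_def power_mult_distrib)
  have Im: "Im z \<noteq> 0" using False by (simp add: z_def)
  have nonint: "w \<notin> \<int>\<^sub>\<le>\<^sub>0" if "Im w \<noteq> 0" for w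
    using that by (auto elim!: nonpos_Ints_cases)
  have nz: "z \<noteq> 0" using Im by auto
  have "Gamma (1 + z) = z * Gamma z"
    using Gamma_plus1[OF nonint[OF Im]] by (simp add: add.commute)
  then have eq: "char logistic_distribution t = of_real pi * z / sin (of_real pi * z)"
    using Gamma_reflection_complex[of z] char_logistic_distribution_eq[of t]
    by (simp add: mult_ac z_def)
  \<comment> \<open>The reciprocal Gamma function vanishes only at nonpositive integers, whereas z
    and 1 - z are not real.\<close>
  have "sin (of_real pi * z) \<noteq> 0"
  proof
    assume "sin (of_real pi * z) = 0"
    then have "rGamma z * rGamma (1 - z) = 0" by (simp add: rGamma_reflection_complex)
    then show False using nonint[of z] nonint[of "1 - z"] Im by (simp add: rGamma_eq_zero_iff)
  qed
  then have "(\<lambda>n. of_real pi * z / (of_real pi * z * (\<Prod>k=1..n. 1 - z^2 / of_nat k^2)))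
      \<longlonglongrightarrow> of_real pi * z / sin (of_real pi * z)"
    by (intro tendsto_divide tendsto_const sin_product_formula_complex)
  moreover have "of_real pi * z / (of_real pi * z * (\<Prod>k=1..n. 1 - z^2 / of_nat k^2))
      = (\<Prod>k=1..n. 1 / (1 + complex_of_real (t\<^sup>2) / of_nat k ^ 2))" for n
    using nz by (simp add: prod_dividef z2)
  ultimately show ?thesis unfolding eq by simp
qed

section \<open>Auxiliary product spaces and almost surely convergent series\<close>

lemma product_real_distributions:
  fixes F :: "'i \<Rightarrow> real measure"
  assumes F: "\<And>i. real_distribution (F i)"
  shows "prob_space (PiM UNIV F)"
    and "prob_space.indep_vars (PiM UNIV F) (\<lambda>_. borel) (\<lambda>i \<omega>. \<omega> i) UNIV"
    and "\<And>i. distr (PiM UNIV F) borel (\<lambda>\<omega>. \<omega> i) = F i"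
proof -
  have pF: "prob_space (F i)" and sF[measurable_cong]: "sets (F i) = sets borel" for i
    using F[of i] by (auto simp: real_distribution_def real_distribution_axioms_def)
  show p: "prob_space (PiM UNIV F)" by (rule prob_space_PiM) (rule pF)
  interpret prob_space "PiM UNIV F" by fact
  show d: "distr (PiM UNIV F) borel (\<lambda>\<omega>. \<omega> i) = F i" for i
    using distr_PiM_component[of UNIV F i] pF by (simp cong: distr_cong add: sF)
  have "(\<lambda>\<omega>. \<omega> i) \<in> PiM UNIV F \<rightarrow>\<^sub>M borel" for i by simp
  moreover have "distr (PiM UNIV F) (PiM UNIV (\<lambda>_. borel)) (\<lambda>x. \<lambda>i\<in>UNIV. x i) = PiM UNIV F"
  proof -
    have "distr (PiM UNIV F) (PiM UNIV (\<lambda>_. borel)) (\<lambda>x. \<lambda>i\<in>UNIV. x i)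
        = distr (PiM UNIV F) (PiM UNIV F) (\<lambda>x. x)"
      by (intro distr_cong refl sets_PiM_cong) (auto simp: sF)
    then show ?thesis by (simp add: distr_id2)
  qed
  ultimately show "indep_vars (\<lambda>_. borel) (\<lambda>i \<omega>. \<omega> i) UNIV"
    by (subst indep_vars_iff_distr_eq_PiM) (auto simp: d)
qed

text \<open>Tonelli for series: a finite integral of the sum forces the sum to be finite almost
  everywhere, and absolute convergence then justifies the exchange.\<close>

lemma AE_summable_if_summable_integral:
  fixes f :: "nat \<Rightarrow> 'a \<Rightarrow> real"
  assumes int: "\<And>n. integrable M (f n)" and nn: "\<And>n. AE x in M. 0 \<le> f n x"
    and sum: "summable (\<lambda>n. \<integral>x. f n x \<partial>M)"
  shows "AE x in M. summable (\<lambda>n. f n x)"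
    and "integrable M (\<lambda>x. \<Sum>n. f n x)"
    and "(\<integral>x. (\<Sum>n. f n x) \<partial>M) = (\<Sum>n. \<integral>x. f n x \<partial>M)"
proof -
  have [measurable]: "f n \<in> borel_measurable M" for n using int[of n] by simp
  have nn': "AE x in M. \<forall>n. 0 \<le> f n x" using nn by (simp add: AE_all_countable)
  have "(\<integral>\<^sup>+x. (\<Sum>n. ennreal (f n x)) \<partial>M) = (\<Sum>n. \<integral>\<^sup>+x. ennreal (f n x) \<partial>M)"
    by (rule nn_integral_suminf) simp
  also have "\<dots> = (\<Sum>n. ennreal (\<integral>x. f n x \<partial>M))"
    using int nn by (simp add: nn_integral_eq_integral)
  also have "\<dots> \<noteq> \<infinity>"
    unfolding infinity_ennreal_def by (rule ennreal_suminf_neq_top[OF sum integral_nonneg_AE[OF nn]])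
  finally have "AE x in M. (\<Sum>n. ennreal (f n x)) \<noteq> \<infinity>"
    by (intro nn_integral_PInf_AE) auto
  with nn' show s: "AE x in M. summable (\<lambda>n. f n x)"
  proof eventually_elim
    case (elim x)
    then show ?case by (auto intro!: summable_suminf_not_top)
  qed
  have s': "AE x in M. summable (\<lambda>n. norm (f n x))"
    using s nn' by eventually_elim simp
  have "(\<integral>x. norm (f n x) \<partial>M) = (\<integral>x. f n x \<partial>M)" for n
    using nn[of n] by (intro integral_cong_AE) auto
  then have sum': "summable (\<lambda>n. \<integral>x. norm (f n x) \<partial>M)" using sum by simp
  show "integrable M (\<lambda>x. \<Sum>n. f n x)" by (rule integrable_suminf[OF int s' sum'])
  show "(\<integral>x. (\<Sum>n. f n x) \<partial>M) = (\<Sum>n. \<integral>x. f n x \<partial>M)" by (rule integral_suminf[OF int s' sum'])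
qed

text \<open>Cauchy-Schwarz for the sequences sqrt c_n and sqrt c_n x_n. It serves twice: to bound E
  V^2, and to dominate all partial sums of an orthogonal series by one integrable function.\<close>

lemma weighted_Cauchy_Schwarz_series:
  fixes c x :: "nat \<Rightarrow> real"
  assumes c: "\<And>n. 0 \<le> c n" "summable c" and x: "summable (\<lambda>n. c n * (x n)\<^sup>2)"
  shows "summable (\<lambda>n. \<bar>c n * x n\<bar>)"
    and "finite I \<Longrightarrow> (\<Sum>n\<in>I. c n * x n)\<^sup>2 \<le> suminf c * (\<Sum>n. c n * (x n)\<^sup>2)"
    and "(\<Sum>n. c n * x n)\<^sup>2 \<le> suminf c * (\<Sum>n. c n * (x n)\<^sup>2)"
proof -
  have le: "\<bar>y\<bar> \<le> 1 + y\<^sup>2" for y :: real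
    using sum_squares_ge_zero[of "\<bar>y\<bar> - 1" 0] by (simp add: power2_eq_square algebra_simps abs_if split: if_splits)
  show s: "summable (\<lambda>n. \<bar>c n * x n\<bar>)"
  proof (rule summable_comparison_test'[OF summable_add[OF c(2) x]])
    fix n show "norm \<bar>c n * x n\<bar> \<le> c n + c n * (x n)\<^sup>2"
      using mult_left_mono[OF le[of "x n"] c(1)[of n]] c(1)[of n] by (simp add: abs_mult algebra_simps)
  qed
  show fin: "(\<Sum>n\<in>I. c n * x n)\<^sup>2 \<le> suminf c * (\<Sum>n. c n * (x n)\<^sup>2)" if I: "finite I" for I
  proof -
    have "(\<Sum>n\<in>I. c n * x n)\<^sup>2 = (\<Sum>n\<in>I. sqrt (c n) * (sqrt (c n) * x n))\<^sup>2"
      using c(1) by (simp add: mult.assoc[symmetric])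
    also have "\<dots> \<le> (\<Sum>n\<in>I. (sqrt (c n))\<^sup>2) * (\<Sum>n\<in>I. (sqrt (c n) * x n)\<^sup>2)"
      by (rule Cauchy_Schwarz_ineq_sum)
    also have "\<dots> = (\<Sum>n\<in>I. c n) * (\<Sum>n\<in>I. c n * (x n)\<^sup>2)"
      using c(1) by (simp add: power_mult_distrib)
    also have "\<dots> \<le> suminf c * (\<Sum>n. c n * (x n)\<^sup>2)"
      using c x I by (intro mult_mono sum_le_suminf suminf_nonneg sum_nonneg) auto
    finally show ?thesis .
  qed
  show "(\<Sum>n. c n * x n)\<^sup>2 \<le> suminf c * (\<Sum>n. c n * (x n)\<^sup>2)"
  proof (rule LIMSEQ_le_const2)
    show "(\<lambda>m. (\<Sum>n<m. c n * x n)\<^sup>2) \<longlonglongrightarrow> (\<Sum>n. c n * x n)\<^sup>2"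
      using summable_rabs_cancel[OF s] by (intro tendsto_power summable_LIMSEQ)
  qed (use fin in auto)
qed

section \<open>The mixing law of the logistic distribution\<close>

lemma exp_distribution_moments:
  "has_bochner_integral exp_distribution (\<lambda>x. x ^ i) (fact i)"
proof -
  interpret E: real_distribution exp_distribution by (rule real_distribution_exp_distribution)
  have "distributed exp_distribution lborel (\<lambda>x. x) (exponential_density 1)"
    unfolding distributed_def by (auto simp: distr_id2)
  from E.has_bochner_integral_erlang_ith_moment[OF _ this, of i] show ?thesis by simp
qed

lemma exp_distribution_Laplace:
  assumes "0 \<le> c"
  shows "(\<integral>x. exp (- (c * x)) \<partial>exp_distribution) = 1 / (1 + c)"
proof -
  have "(\<integral>\<^sup>+x. ennreal (exp (- (c * x))) \<partial>exp_distribution)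
     = (\<integral>\<^sup>+x. ennreal (exp (- (1 + c) * x)) * indicator {0..} x \<partial>lborel)"
    by (subst nn_integral_density)
       (auto intro!: nn_integral_cong simp: exponential_density_def ennreal_mult[symmetric]
         exp_add[symmetric] algebra_simps split: split_indicator)
  also have "\<dots> = 0 - (- exp (- (1 + c) * 0) / (1 + c))"
  proof (rule nn_integral_FTC_atLeast)
    show "((\<lambda>v. - exp (- (1 + c) * v) / (1 + c)) \<longlongrightarrow> 0) at_top"
      using assms by real_asymp
    show "((\<lambda>v. - exp (- (1 + c) * v) / (1 + c)) has_real_derivative exp (- (1 + c) * v)) (at v)" for v
    proof -
      have "((\<lambda>v. - exp (- d * v) / d) has_real_derivative exp (- d * v)) (at v)" if "d \<noteq> 0" for d
        using that by (auto intro!: derivative_eq_intros)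
      from this[of "1 + c"] show ?thesis using assms by simp
    qed
  qed auto
  finally show ?thesis using assms by (subst integral_eq_nn_integral) auto
qed

text \<open>\<open>\<nu>\<close> is the law of V = sum of c_k E_k. The Laplace transform of c E at u
  is 1 / (1 + u c); at u = t^2/2 with c = 2/k^2 these are exactly the factors of the logistic
  characteristic function.\<close>

lemma logistic_is_gauss_mixture:
  obtains \<nu> where "real_distribution \<nu>" "AE s in \<nu>. 0 < s" "integrable \<nu> (\<lambda>s. s\<^sup>2)"
    "(\<integral>s. s \<partial>\<nu>) = pi\<^sup>2 / 3" "(\<integral>s. s\<^sup>2 \<partial>\<nu>) \<le> 2 * (pi\<^sup>2 / 3)\<^sup>2"
    "gauss_mixture \<nu> = logistic_distribution"
proof -
  define B where "B = PiM (UNIV :: nat set) (\<lambda>_. exp_distribution)"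
  note pr = product_real_distributions[of "\<lambda>_::nat. exp_distribution", OF real_distribution_exp_distribution, folded B_def]
  interpret prob_space B by (rule pr(1))
  have [measurable]: "(\<lambda>\<omega>. \<omega> k) \<in> borel_measurable B" for k :: nat
    using pr(2) by (simp add: indep_vars_def)
  \<comment> \<open>Indices start at 0, hence the shift k + 1. The numerator 2 cancels the 1/2 in
    t^2/2 and makes the total weight pi^2/3, the logistic variance.\<close>
  define c :: "nat \<Rightarrow> real" where "c k = 2 / (real k + 1)\<^sup>2" for k
  define V where "V \<omega> = (\<Sum>k. c k * \<omega> k)" for \<omega>
  have c_pos: "0 < c k" for k by (simp add: c_def)
  have c_sums: "c sums (pi\<^sup>2 / 3)"
    using sums_mult[OF inverse_squares_sums, of 2] by (simp add: c_def[abs_def] add.commute)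
  then have c_summable: "summable c" and c_sum: "suminf c = pi\<^sup>2 / 3" by (auto simp: sums_iff)
  have mom: "has_bochner_integral B (\<lambda>\<omega>. \<omega> k ^ i) (fact i)" for k i
  proof -
    have "has_bochner_integral (distr B borel (\<lambda>\<omega>. \<omega> k)) (\<lambda>x. x ^ i) (fact i)"
      unfolding pr(3) by (rule exp_distribution_moments)
    then show ?thesis
      by (simp add: has_bochner_integral_iff integrable_distr_eq integral_distr)
  qed
  have pos: "AE \<omega> in B. \<forall>k. 0 < \<omega> k"
  proof (subst AE_all_countable, rule allI)
    fix k
    have "AE x in distr B borel (\<lambda>\<omega>. \<omega> k). 0 < x" unfolding pr(3) by (rule AE_exp_distribution_pos)
    then show "AE \<omega> in B. 0 < \<omega> k" by (subst (asm) AE_distr_iff) auto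
  qed
  have sq: "AE \<omega> in B. summable (\<lambda>k. c k * (\<omega> k)\<^sup>2)"
     "integrable B (\<lambda>\<omega>. \<Sum>k. c k * (\<omega> k)\<^sup>2)"
     "(\<integral>\<omega>. (\<Sum>k. c k * (\<omega> k)\<^sup>2) \<partial>B) = (\<Sum>k. \<integral>\<omega>. c k * (\<omega> k)\<^sup>2 \<partial>B)"
  proof -
    have i: "integrable B (\<lambda>\<omega>. c k * (\<omega> k)\<^sup>2)" "(\<integral>\<omega>. c k * (\<omega> k)\<^sup>2 \<partial>B) = c k * 2" for k
      using mom[of k 2] by (auto simp: has_bochner_integral_iff)
    note S = AE_summable_if_summable_integral[of B "\<lambda>k \<omega>. c k * (\<omega> k)\<^sup>2", OF i(1)]
    have "0 \<le> c k * (\<omega> k)\<^sup>2" for k \<omega> using c_pos[of k] by simp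
    moreover have "summable (\<lambda>k. \<integral>\<omega>. c k * (\<omega> k)\<^sup>2 \<partial>B)"
      unfolding i using c_summable by (rule summable_mult2)
    ultimately show "AE \<omega> in B. summable (\<lambda>k. c k * (\<omega> k)\<^sup>2)"
     "integrable B (\<lambda>\<omega>. \<Sum>k. c k * (\<omega> k)\<^sup>2)"
     "(\<integral>\<omega>. (\<Sum>k. c k * (\<omega> k)\<^sup>2) \<partial>B) = (\<Sum>k. \<integral>\<omega>. c k * (\<omega> k)\<^sup>2 \<partial>B)"
      using S by auto
  qed
  have sq_eq: "(\<integral>\<omega>. (\<Sum>k. c k * (\<omega> k)\<^sup>2) \<partial>B) = 2 * (pi\<^sup>2 / 3)"
  proof -
    have "(\<integral>\<omega>. c k * (\<omega> k)\<^sup>2 \<partial>B) = 2 * c k" for k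
      using mom[of k 2] by (auto simp: has_bochner_integral_iff)
    then have "(\<Sum>k. \<integral>\<omega>. c k * (\<omega> k)\<^sup>2 \<partial>B) = (\<Sum>k. 2 * c k)" by (intro suminf_cong)
    then show ?thesis unfolding sq(3) using suminf_mult[OF c_summable, of 2] c_sum by simp
  qed
  have lin: "integrable B V" "(\<integral>\<omega>. V \<omega> \<partial>B) = pi\<^sup>2 / 3"
  proof -
    have i: "integrable B (\<lambda>\<omega>. c k * \<omega> k)" "(\<integral>\<omega>. c k * \<omega> k \<partial>B) = c k" for k
      using mom[of k 1] by (auto simp: has_bochner_integral_iff)
    have nn: "AE \<omega> in B. 0 \<le> c k * \<omega> k" for k
      using pos by eventually_elim (use c_pos[of k] in \<open>auto intro!: mult_nonneg_nonneg less_imp_le\<close>)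
    note S = AE_summable_if_summable_integral[of B "\<lambda>k \<omega>. c k * \<omega> k", OF i(1) nn]
    show "integrable B V" "(\<integral>\<omega>. V \<omega> \<partial>B) = pi\<^sup>2 / 3"
      using S(2,3) c_summable c_sum unfolding V_def[abs_def] i(2) by auto
  qed
  have [measurable]: "V \<in> borel_measurable B" using lin(1) by simp
  \<comment> \<open>Cauchy-Schwarz with weights c_k of total mass pi^2/3. The right-hand side has
    expectation 2 (pi^2/3)^2, where 2 is the second moment of a standard exponential.\<close>
  have V_sq: "AE \<omega> in B. (V \<omega>)\<^sup>2 \<le> pi\<^sup>2 / 3 * (\<Sum>k. c k * (\<omega> k)\<^sup>2)"
    using sq(1)
  proof eventually_elim
    case (elim \<omega>)
    then show ?case
      using weighted_Cauchy_Schwarz_series(3)[of c \<omega>] c_pos c_summable c_sum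
      by (auto simp: V_def less_imp_le)
  qed
  have V2: "integrable B (\<lambda>\<omega>. (V \<omega>)\<^sup>2)"
  proof (rule Bochner_Integration.integrable_bound)
    show "integrable B (\<lambda>\<omega>. pi\<^sup>2 / 3 * (\<Sum>k. c k * (\<omega> k)\<^sup>2))" using sq(2) by simp
    show "AE \<omega> in B. norm ((V \<omega>)\<^sup>2) \<le> norm (pi\<^sup>2 / 3 * (\<Sum>k. c k * (\<omega> k)\<^sup>2))"
      using V_sq by eventually_elim simp
  qed simp
  have V2_le: "(\<integral>\<omega>. (V \<omega>)\<^sup>2 \<partial>B) \<le> 2 * (pi\<^sup>2 / 3)\<^sup>2"
  proof -
    have "(\<integral>\<omega>. (V \<omega>)\<^sup>2 \<partial>B) \<le> (\<integral>\<omega>. pi\<^sup>2 / 3 * (\<Sum>k. c k * (\<omega> k)\<^sup>2) \<partial>B)"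
      using V_sq sq(2) V2 by (intro integral_mono_AE) auto
    also have "\<dots> = 2 * (pi\<^sup>2 / 3)\<^sup>2" by (simp only: integral_mult_right_zero sq_eq) (simp add: power2_eq_square)
    finally show ?thesis .
  qed
  have good: "AE \<omega> in B. summable (\<lambda>k. c k * \<omega> k) \<and> (\<forall>k. 0 < \<omega> k)"
    using sq(1) pos
  proof eventually_elim
    case (elim \<omega>)
    then show ?case
      using weighted_Cauchy_Schwarz_series(1)[of c \<omega>] c_pos c_summable
      by (auto simp: less_imp_le intro: summable_rabs_cancel)
  qed
  have V_pos: "AE \<omega> in B. 0 < V \<omega>"
    using good by eventually_elim (auto simp: V_def intro!: suminf_pos mult_pos_pos c_pos)
  \<comment> \<open>For partial sums, independence gives the product. All exponents are nonpositive,
    so the constant 1 dominates in the passage to V.\<close>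
  have Laplace: "(\<lambda>n. \<Prod>k<n. 1 / (1 + u * c k)) \<longlonglongrightarrow> (\<integral>\<omega>. exp (- (u * V \<omega>)) \<partial>B)" if u: "0 \<le> u" for u
  proof -
    have "(\<integral>\<omega>. exp (- (u * (\<Sum>k<n. c k * \<omega> k))) \<partial>B) = (\<Prod>k<n. 1 / (1 + u * c k))" for n
    proof -
      have ind: "indep_vars (\<lambda>_. borel) (\<lambda>k \<omega>. exp (- (u * c k * \<omega> k))) {..<n}"
        by (rule indep_vars_compose2[OF indep_vars_subset[OF pr(2)]]) auto
      have "(\<integral>\<omega>. exp (- (u * (\<Sum>k<n. c k * \<omega> k))) \<partial>B) = (\<integral>\<omega>. (\<Prod>k<n. exp (- (u * c k * \<omega> k))) \<partial>B)"
        by (simp add: exp_sum[symmetric] sum_negf sum_distrib_left mult.assoc)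
      also have "\<dots> = (\<Prod>k<n. \<integral>\<omega>. exp (- (u * c k * \<omega> k)) \<partial>B)"
      proof (rule indep_vars_lebesgue_integral[OF _ ind])
        fix k
        show "integrable B (\<lambda>\<omega>. exp (- (u * c k * \<omega> k)))"
        proof (rule integrable_const_bound[where B=1])
          show "AE \<omega> in B. norm (exp (- (u * c k * \<omega> k))) \<le> 1"
            using pos
          proof eventually_elim
            case (elim \<omega>)
            then have "0 \<le> c k * \<omega> k" using c_pos[of k] by (simp add: less_imp_le)
            then have "0 \<le> u * c k * \<omega> k" using u by (simp add: mult.assoc)
            then show ?case by simp
          qed
        qed simp
      qed simp
      also have "\<dots> = (\<Prod>k<n. 1 / (1 + u * c k))"
      proof (rule prod.cong[OF refl])
        fix k
        have "(\<integral>\<omega>. exp (- (u * c k * \<omega> k)) \<partial>B) = (\<integral>x. exp (- (u * c k * x)) \<partial>distr B borel (\<lambda>\<omega>. \<omega> k))"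
          by (simp add: integral_distr)
        also have "\<dots> = 1 / (1 + u * c k)" unfolding pr(3)
          using u c_pos[of k] by (intro exp_distribution_Laplace) auto
        finally show "(\<integral>\<omega>. exp (- (u * c k * \<omega> k)) \<partial>B) = 1 / (1 + u * c k)" .
      qed
      finally show ?thesis .
    qed
    moreover have "(\<lambda>n. \<integral>\<omega>. exp (- (u * (\<Sum>k<n. c k * \<omega> k))) \<partial>B) \<longlonglongrightarrow> (\<integral>\<omega>. exp (- (u * V \<omega>)) \<partial>B)"
    proof (rule integral_dominated_convergence[where w="\<lambda>_. 1"])
      show "AE \<omega> in B. (\<lambda>n. exp (- (u * (\<Sum>k<n. c k * \<omega> k)))) \<longlonglongrightarrow> exp (- (u * V \<omega>))"
        using good unfolding V_def
        by eventually_elim (intro tendsto_exp tendsto_minus tendsto_mult tendsto_const summable_LIMSEQ, simp)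
      show "AE \<omega> in B. norm (exp (- (u * (\<Sum>k<n. c k * \<omega> k)))) \<le> 1" for n
        using pos
      proof eventually_elim
        case (elim \<omega>)
        then have "0 \<le> (\<Sum>k<n. c k * \<omega> k)"
          using c_pos by (intro sum_nonneg) (simp add: less_imp_le)
        then have "0 \<le> u * (\<Sum>k<n. c k * \<omega> k)" using u by simp
        then show ?case by simp
      qed
    qed auto
    ultimately show ?thesis by simp
  qed
  define \<nu> where "\<nu> = distr B borel V"
  have nu: "real_distribution \<nu>" unfolding \<nu>_def by (rule real_distribution_distr) simp
  interpret nu: real_distribution \<nu> by fact
  have nu_pos: "AE s in \<nu>. 0 < s" unfolding \<nu>_def using V_pos by (simp add: AE_distr_iff)
  have "gauss_mixture \<nu> = logistic_distribution"
  proof (rule Levy_uniqueness[OF real_distribution_gauss_mixture[OF nu] real_distribution_logistic], rule ext)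
    fix t
    have "char (gauss_mixture \<nu>) t = (\<integral>s. exp (of_real (- (t\<^sup>2 * s / 2))) \<partial>\<nu>)"
      by (rule char_gauss_mixture[OF nu]) (use nu_pos in \<open>auto elim!: eventually_mono\<close>)
    also have "\<dots> = (\<integral>\<omega>. of_real (exp (- (t\<^sup>2 / 2 * V \<omega>))) \<partial>B)"
      unfolding \<nu>_def by (subst integral_distr) (auto simp: exp_of_real[symmetric])
    also have "\<dots> = of_real (\<integral>\<omega>. exp (- (t\<^sup>2 / 2 * V \<omega>)) \<partial>B)"
      by (rule integral_complex_of_real)
    finally have eq: "char (gauss_mixture \<nu>) t = of_real (\<integral>\<omega>. exp (- (t\<^sup>2 / 2 * V \<omega>)) \<partial>B)" .
    have "(\<lambda>n. of_real (\<Prod>k<n. 1 / (1 + t\<^sup>2 / 2 * c k)) :: complex) \<longlonglongrightarrow> char (gauss_mixture \<nu>) t"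
      unfolding eq by (intro tendsto_of_real Laplace) simp
    moreover have "of_real (\<Prod>k<n. 1 / (1 + t\<^sup>2 / 2 * c k))
        = (\<Prod>k=1..n. 1 / (1 + complex_of_real (t\<^sup>2) / of_nat k ^ 2))" for n
      by (simp add: prod.atLeast1_atMost_eq c_def add.commute)
    ultimately show "char (gauss_mixture \<nu>) t = char logistic_distribution t"
      using char_logistic_distribution[of t] by (auto intro: LIMSEQ_unique)
  qed
  moreover have "integrable \<nu> (\<lambda>s. s\<^sup>2)" "(\<integral>s. s \<partial>\<nu>) = pi\<^sup>2 / 3" "(\<integral>s. s\<^sup>2 \<partial>\<nu>) \<le> 2 * (pi\<^sup>2 / 3)\<^sup>2"
    using V2 V2_le lin(2) unfolding \<nu>_def by (simp_all add: integrable_distr_eq integral_distr)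
  ultimately show thesis using that nu nu_pos by blast
qed

section \<open>Series of compound Poisson sums\<close>

lemma integrable_mult_of_square_integrable:
  fixes f g :: "'a \<Rightarrow> real"
  assumes [measurable]: "f \<in> borel_measurable M" "g \<in> borel_measurable M"
    and "integrable M (\<lambda>x. (f x)\<^sup>2)" "integrable M (\<lambda>x. (g x)\<^sup>2)"
  shows "integrable M (\<lambda>x. f x * g x)"
proof (rule Bochner_Integration.integrable_bound)
  show "integrable M (\<lambda>x. (f x)\<^sup>2 + (g x)\<^sup>2)" using assms by simp
  have "\<bar>a * b\<bar> \<le> a\<^sup>2 + b\<^sup>2" for a b :: real
    using sum_squares_bound[of "\<bar>a\<bar>" "\<bar>b\<bar>"] abs_ge_zero[of "a * b"] unfolding abs_mult power2_abs by linarith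
  then show "AE x in M. norm (f x * g x) \<le> norm ((f x)\<^sup>2 + (g x)\<^sup>2)" by simp
qed simp

text \<open>Summable variances alone do not make an orthogonal series converge almost everywhere.
  The stronger demand that v_n / c_n be summable for some summable weights c does: the sum of W_n^2
  / c_n is then integrable and, by Cauchy-Schwarz, controls the series.\<close>

lemma orthogonal_series:
  fixes W :: "nat \<Rightarrow> 'a \<Rightarrow> real"
  assumes W[measurable]: "\<And>n. W n \<in> borel_measurable M"
    and W2: "\<And>n. integrable M (\<lambda>x. (W n x)\<^sup>2)"
    and v: "\<And>n. (\<integral>x. (W n x)\<^sup>2 \<partial>M) = v n"
    and orth: "\<And>m n. m \<noteq> n \<Longrightarrow> (\<integral>x. W m x * W n x \<partial>M) = 0"
    and c: "\<And>n. 0 < c n" "summable c" and vc: "summable (\<lambda>n. v n / c n)"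
  shows "AE x in M. summable (\<lambda>n. W n x)"
    and "integrable M (\<lambda>x. (\<Sum>n. W n x)\<^sup>2)"
    and "v sums (\<integral>x. (\<Sum>n. W n x)\<^sup>2 \<partial>M)"
proof -
  have c0: "0 \<le> c n" "c n \<noteq> 0" for n using c(1)[of n] by auto
  \<comment> \<open>An integrable majorant of the squares of all partial sums and of the limit; it
    permits dominated convergence of the second moments.\<close>
  define G where "G x = suminf c * (\<Sum>n. (W n x)\<^sup>2 / c n)" for x
  note S = AE_summable_if_summable_integral[of M "\<lambda>n x. (W n x)\<^sup>2 / c n"]
  have i: "integrable M (\<lambda>x. (W n x)\<^sup>2 / c n)" for n using W2 by simp
  have nn: "AE x in M. 0 \<le> (W n x)\<^sup>2 / c n" for n using c0 by simp
  have s: "summable (\<lambda>n. \<integral>x. (W n x)\<^sup>2 / c n \<partial>M)" using vc v by simp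
  have intG: "integrable M G" unfolding G_def[abs_def] using S(2)[OF i nn s] by simp
  have [measurable]: "G \<in> borel_measurable M" using intG by simp
  have good: "AE x in M. summable (\<lambda>n. (W n x)\<^sup>2 / c n)" by (rule S(1)[OF i nn s])
  have CS: "summable (\<lambda>n. \<bar>W n x\<bar>)" "finite I \<Longrightarrow> (\<Sum>n\<in>I. W n x)\<^sup>2 \<le> G x" "(\<Sum>n. W n x)\<^sup>2 \<le> G x"
    if "summable (\<lambda>n. (W n x)\<^sup>2 / c n)" for x I
  proof -
    have "c n * (W n x / c n)\<^sup>2 = (W n x)\<^sup>2 / c n" "c n * (W n x / c n) = W n x" for n
      using c0 by (auto simp: power2_eq_square)
    then show "summable (\<lambda>n. \<bar>W n x\<bar>)" "finite I \<Longrightarrow> (\<Sum>n\<in>I. W n x)\<^sup>2 \<le> G x" "(\<Sum>n. W n x)\<^sup>2 \<le> G x"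
      using weighted_Cauchy_Schwarz_series(1,3)[of c "\<lambda>n. W n x / c n"]
        weighted_Cauchy_Schwarz_series(2)[of c "\<lambda>n. W n x / c n" I] c0 c(2) that by (auto simp: G_def)
  qed
  show summable: "AE x in M. summable (\<lambda>n. W n x)"
    using good by eventually_elim (auto intro: summable_rabs_cancel dest: CS(1))
  have conv: "AE x in M. (\<lambda>m. (\<Sum>n<m. W n x)\<^sup>2) \<longlonglongrightarrow> (\<Sum>n. W n x)\<^sup>2"
    using summable by eventually_elim (intro tendsto_power summable_LIMSEQ)
  have bound: "AE x in M. norm ((\<Sum>n<m. W n x)\<^sup>2) \<le> G x" for m
    using good by eventually_elim (simp add: CS(2))
  have prod_int: "integrable M (\<lambda>x. W m x * W n x)" for m n
    using W2 by (intro integrable_mult_of_square_integrable) auto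
  show "integrable M (\<lambda>x. (\<Sum>n. W n x)\<^sup>2)"
    by (rule integrable_dominated_convergence[OF _ _ intG conv bound]) simp_all
  have "(\<lambda>m. \<integral>x. (\<Sum>n<m. W n x)\<^sup>2 \<partial>M) \<longlonglongrightarrow> (\<integral>x. (\<Sum>n. W n x)\<^sup>2 \<partial>M)"
    by (rule integral_dominated_convergence[OF _ _ intG conv bound]) simp_all
  moreover have "(\<integral>x. (\<Sum>n<m. W n x)\<^sup>2 \<partial>M) = (\<Sum>n<m. v n)" for m
  proof -
    have "(\<integral>x. (\<Sum>n<m. W n x)\<^sup>2 \<partial>M) = (\<integral>x. (\<Sum>i<m. \<Sum>j<m. W i x * W j x) \<partial>M)"
      by (simp add: power2_eq_square sum_product)
    also have "\<dots> = (\<Sum>i<m. \<Sum>j<m. \<integral>x. W i x * W j x \<partial>M)"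
      by (subst Bochner_Integration.integral_sum, intro Bochner_Integration.integrable_sum prod_int)
         (intro sum.cong refl Bochner_Integration.integral_sum prod_int)
    also have "\<dots> = (\<Sum>i<m. \<Sum>j<m. if j = i then v i else 0)"
      using v orth by (intro sum.cong refl) (auto simp: power2_eq_square)
    also have "\<dots> = (\<Sum>n<m. v n)" by simp
    finally show ?thesis .
  qed
  ultimately show "v sums (\<integral>x. (\<Sum>n. W n x)\<^sup>2 \<partial>M)" by (simp add: sums_def)
qed

section \<open>Poisson weights and moments of compound Poisson sums\<close>

lemma poisson_mass_nonneg: "0 \<le> l \<Longrightarrow> 0 \<le> poisson_mass l j"
  by (simp add: poisson_mass_def)

lemma poisson_mass_generating_function:
  fixes z :: complex
  shows "(\<lambda>j. of_real (poisson_mass l j) * z ^ j) sums exp (of_real l * (z - 1))"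
proof -
  have "(\<lambda>j. ((of_real l * z) ^ j /\<^sub>R fact j) * of_real (exp (- l))) sums (exp (of_real l * z) * of_real (exp (- l)))"
    by (intro sums_mult2 exp_converges)
  moreover have "exp (of_real l * z) * of_real (exp (- l)) = exp (of_real l * (z - 1))"
    by (simp add: exp_of_real[symmetric] exp_add[symmetric] algebra_simps)
  moreover have "((of_real l * z) ^ j /\<^sub>R fact j) * of_real (exp (- l)) = of_real (poisson_mass l j) * z ^ j" for j
    by (simp add: poisson_mass_def scaleR_conv_of_real power_mult_distrib divide_inverse mult_ac)
  ultimately show ?thesis by simp
qed

lemma poisson_mass_Suc: "poisson_mass l (Suc j) * real (Suc j) = l * poisson_mass l j"
  by (simp add: poisson_mass_def divide_simps del: of_nat_Suc)

text \<open>Each line follows from the preceding one by the shift j p_j = l p_(j-1). Factorial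
  moments are the convenient ones: j and j (j - 1) count the equal and the unequal index pairs in
  the square of a sum of j jumps.\<close>

lemma poisson_mass_factorial_moments:
  shows "(\<lambda>j. poisson_mass l j) sums 1"
    and "(\<lambda>j. poisson_mass l j * real j) sums l"
    and "(\<lambda>j. poisson_mass l j * (real j * (real j - 1))) sums l\<^sup>2"
proof -
  have "(\<lambda>j. (l ^ j /\<^sub>R fact j) * exp (- l)) sums (exp l * exp (- l))"
    by (intro sums_mult2 exp_converges)
  then show 0: "(\<lambda>j. poisson_mass l j) sums 1"
    by (simp add: poisson_mass_def exp_add[symmetric] divide_inverse mult_ac)
  have "(\<lambda>j. poisson_mass l (Suc j) * real (Suc j)) sums l"
    unfolding poisson_mass_Suc using sums_mult[OF 0, of l] by simp
  then show 1: "(\<lambda>j. poisson_mass l j * real j) sums l"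
    by (subst (asm) sums_Suc_iff) simp
  have "poisson_mass l (Suc j) * (real (Suc j) * (real (Suc j) - 1)) = l * (poisson_mass l j * real j)" for j
    using poisson_mass_Suc[of l j] by (simp only: mult.assoc[symmetric]) simp
  moreover have "(\<lambda>j. l * (poisson_mass l j * real j)) sums l\<^sup>2"
    using sums_mult[OF 1, of l] by (simp add: power2_eq_square)
  ultimately have "(\<lambda>j. poisson_mass l (Suc j) * (real (Suc j) * (real (Suc j) - 1))) sums l\<^sup>2"
    by (simp only:)
  then show "(\<lambda>j. poisson_mass l j * (real j * (real j - 1))) sums l\<^sup>2"
    by (subst (asm) sums_Suc_iff) simp
qed

text \<open>Counts are cast to reals so that every variable takes values in \<open>borel\<close> and
  a single independence statement covers the family. Later constructions recover a count by
  \<open>nat\<close> of the floor.\<close>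

definition rv_family :: "('a \<Rightarrow> real) \<Rightarrow> (nat \<Rightarrow> nat \<Rightarrow> 'a \<Rightarrow> real) \<Rightarrow> (nat \<Rightarrow> 'a \<Rightarrow> nat) \<Rightarrow> rv_idx \<Rightarrow> 'a \<Rightarrow> real" where
  "rv_family X Y P = (\<lambda>i. case i of IX \<Rightarrow> X | IY n k \<Rightarrow> Y n k | IP n \<Rightarrow> (\<lambda>\<omega>. real (P n \<omega>)))"

definition rv_indices :: "rv_idx set" where
  "rv_indices = {IX} \<union> {IY n k | n k. k \<ge> 1} \<union> range IP"

lemma rv_family_simps [simp]:
  "rv_family X Y P IX = X" "rv_family X Y P (IY n k) = Y n k" "rv_family X Y P (IP n) = (\<lambda>\<omega>. real (P n \<omega>))"
  by (simp_all add: rv_family_def)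

lemma rv_indices_simps [simp]:
  "IX \<in> rv_indices" "IP n \<in> rv_indices" "IY n k \<in> rv_indices \<longleftrightarrow> 1 \<le> k"
  by (auto simp: rv_indices_def)

text \<open>Jump law \<open>D\<close> and base intensity \<open>b\<close> are parameters because the
  locale is used for two families with equal intensities: the given one with logistic jumps, and a
  companion on another space whose jumps have the mixing law.\<close>

locale compound_poisson = prob_space M for M :: "'a measure" +
  fixes X :: "'a \<Rightarrow> real" and Y :: "nat \<Rightarrow> nat \<Rightarrow> 'a \<Rightarrow> real" and P :: "nat \<Rightarrow> 'a \<Rightarrow> nat"
    and D :: "real measure" and b :: real
  assumes D: "real_distribution D" and D_square: "integrable D (\<lambda>x. x\<^sup>2)"
    and b_nonneg: "0 \<le> b"
    and distr_Y: "\<And>n k. 1 \<le> k \<Longrightarrow> distr M borel (Y n k) = D"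
    and distributed_P: "\<And>n. distributed M (count_space UNIV) (P n) (\<lambda>j. ennreal (poisson_mass (b * 2 ^ n) j))"
    and indep: "indep_vars (\<lambda>_. borel) (rv_family X Y P) rv_indices"
begin

sublocale D: real_distribution D by (rule D)

definition rate :: "nat \<Rightarrow> real" where "rate n = b * 2 ^ n"
abbreviation mean :: real where "mean \<equiv> (\<integral>x. x \<partial>D)"
abbreviation second_moment :: real where "second_moment \<equiv> (\<integral>x. x\<^sup>2 \<partial>D)"

definition jump_sum :: "nat \<Rightarrow> 'a \<Rightarrow> real" where
  "jump_sum n \<omega> = (\<Sum>k = 1..P n \<omega>. Y n k \<omega>)"

lemma measurable_X [measurable]: "X \<in> borel_measurable M"
  using indep unfolding indep_vars_def by (auto dest!: bspec[where x=IX])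

lemma measurable_Y: "1 \<le> k \<Longrightarrow> Y n k \<in> borel_measurable M"
  using indep unfolding indep_vars_def by (auto dest!: bspec[where x="IY n k"])

lemma measurable_P [measurable]: "P n \<in> M \<rightarrow>\<^sub>M count_space UNIV"
  using distributed_P by (rule distributed_measurable)

lemma measurable_jump_sum [measurable]: "jump_sum n \<in> borel_measurable M"
proof -
  have "(\<lambda>\<omega>. (\<Sum>k = 1..P n \<omega>. Y n k \<omega>)) \<in> borel_measurable M"
    by (rule measurable_compose_countable[where f="\<lambda>j \<omega>. \<Sum>k = 1..j. Y n k \<omega>" and g="P n"])
       (auto intro!: borel_measurable_sum measurable_Y)
  then show ?thesis by (simp add: jump_sum_def[abs_def])
qed

lemma integrable_D_id: "integrable D (\<lambda>x. x)"
  by (rule D.square_integrable_imp_integrable[OF _ D_square]) simp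

lemma expectation_indicator_P:
  "expectation (\<lambda>\<omega>. indicator {j} (P n \<omega>)) = poisson_mass (rate n) j"
proof -
  have "emeasure M (P n -` {j} \<inter> space M) = (\<integral>\<^sup>+i. ennreal (poisson_mass (rate n) i) * indicator {j} i \<partial>count_space UNIV)"
    using distributed_emeasure[OF distributed_P, of "{j}" n] by (simp add: rate_def)
  also have "\<dots> = ennreal (poisson_mass (rate n) j)"
    by (simp add: nn_integral_count_space_indicator[symmetric] nn_integral_count_space_finite)
  finally have "measure M (P n -` {j} \<inter> space M) = poisson_mass (rate n) j"
    using b_nonneg by (simp add: measure_def poisson_mass_nonneg rate_def)
  moreover have "(\<lambda>\<omega>. indicator {j} (P n \<omega>) :: real) = indicator (P n -` {j})"
    by (auto simp: indicator_def)
  ultimately show ?thesis by simp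
qed

lemma integrable_indicator_P: "integrable M (\<lambda>\<omega>. indicator {j} (P n \<omega>) :: real)"
  by (rule integrable_const_bound[where B=1]) (auto simp: indicator_def)

lemma indicator_P_scaleR:
  fixes x :: "'b::real_vector"
  shows "indicator {j} (P n \<omega>) *\<^sub>R x = (if j = P n \<omega> then x else 0)"
  by (simp add: indicator_def)

text \<open>On the event P_n = j the random number of jumps becomes fixed, and independence of P_n
  from the jumps factorises the expectation. The value type is a general normed field so that the
  same fact serves real moments and complex exponentials.\<close>

lemma expectation_fixed_number_of_jumps:
  fixes g :: "nat \<Rightarrow> real \<Rightarrow> 'b::{real_normed_field, banach, second_countable_topology}"
  assumes K: "finite K" "\<And>k. k \<in> K \<Longrightarrow> 1 \<le> k" and g: "\<And>k. k \<in> K \<Longrightarrow> integrable D (g k)"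
  shows "integrable M (\<lambda>\<omega>. indicator {j} (P n \<omega>) *\<^sub>R (\<Prod>k\<in>K. g k (Y n k \<omega>)))"
    and "expectation (\<lambda>\<omega>. indicator {j} (P n \<omega>) *\<^sub>R (\<Prod>k\<in>K. g k (Y n k \<omega>)))
      = poisson_mass (rate n) j *\<^sub>R (\<Prod>k\<in>K. \<integral>x. g k x \<partial>D)"
proof -
  \<comment> \<open>One test function per index: \<open>g k\<close> on a jump, and on the count the
    indicator of \<open>real j\<close>, because the family stores the count as a real.\<close>
  define \<Phi> :: "rv_idx \<Rightarrow> real \<Rightarrow> 'b" where
    "\<Phi> i = (case i of IY n k \<Rightarrow> g k | _ \<Rightarrow> (\<lambda>x. of_real (indicator {real j} x)))" for i
  let ?I = "insert (IP n) (IY n ` K)"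
  have [measurable]: "g k \<in> borel_measurable borel" if "k \<in> K" for k
    using borel_measurable_integrable[OF g[OF that]] by simp
  have "indep_vars (\<lambda>_. borel) (rv_family X Y P) ?I"
    by (rule indep_vars_subset[OF indep]) (use K in auto)
  then have ind: "indep_vars (\<lambda>_. borel) (\<lambda>i \<omega>. \<Phi> i (rv_family X Y P i \<omega>)) ?I"
    by (rule indep_vars_compose2) (auto simp: \<Phi>_def)
  have YD: "integrable M (\<lambda>\<omega>. g k (Y n k \<omega>))" "expectation (\<lambda>\<omega>. g k (Y n k \<omega>)) = (\<integral>x. g k x \<partial>D)"
    if "k \<in> K" for k
  proof -
    have m: "Y n k \<in> borel_measurable M" "g k \<in> borel_measurable borel"
      using measurable_Y[OF K(2)[OF that]] that by simp_all
    show "integrable M (\<lambda>\<omega>. g k (Y n k \<omega>))"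
      using g[OF that] unfolding distr_Y[OF K(2)[OF that], of n, symmetric] by (simp only: integrable_distr_eq[OF m])
    show "expectation (\<lambda>\<omega>. g k (Y n k \<omega>)) = (\<integral>x. g k x \<partial>D)"
      unfolding distr_Y[OF K(2)[OF that], of n, symmetric] by (simp only: integral_distr[OF m])
  qed
  have ip: "integrable M (\<lambda>\<omega>. of_real (indicator {j} (P n \<omega>)) :: 'b)"
    by (rule integrable_const_bound[where B=1]) (auto simp: indicator_def)
  have int: "integrable M (\<lambda>\<omega>. \<Phi> i (rv_family X Y P i \<omega>))" if "i \<in> ?I" for i
    using that YD ip by (auto simp: \<Phi>_def indicator_def)
  have prod: "(\<Prod>i\<in>?I. \<Phi> i (rv_family X Y P i \<omega>)) = indicator {j} (P n \<omega>) *\<^sub>R (\<Prod>k\<in>K. g k (Y n k \<omega>))" for \<omega>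
  proof -
    have "inj_on (IY n) K" by (auto simp: inj_on_def)
    then show ?thesis using K(1)
      by (subst prod.insert) (auto simp: \<Phi>_def prod.reindex scaleR_conv_of_real indicator_def)
  qed
  have fin: "finite ?I" using K by simp
  show "integrable M (\<lambda>\<omega>. indicator {j} (P n \<omega>) *\<^sub>R (\<Prod>k\<in>K. g k (Y n k \<omega>)))"
    using indep_vars_integrable[OF fin ind int] unfolding prod .
  have "expectation (\<lambda>\<omega>. indicator {j} (P n \<omega>) *\<^sub>R (\<Prod>k\<in>K. g k (Y n k \<omega>)))
     = (\<Prod>i\<in>?I. expectation (\<lambda>\<omega>. \<Phi> i (rv_family X Y P i \<omega>)))"
    using indep_vars_lebesgue_integral[OF fin ind int] unfolding prod .
  also have "\<dots> = expectation (\<lambda>\<omega>. of_real (indicator {j} (P n \<omega>))) * (\<Prod>k\<in>K. \<integral>x. g k x \<partial>D)"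
  proof -
    have "inj_on (IY n) K" by (auto simp: inj_on_def)
    moreover have "(\<lambda>\<omega>. \<Phi> (IP n) (rv_family X Y P (IP n) \<omega>)) = (\<lambda>\<omega>. of_real (indicator {j} (P n \<omega>)))"
      by (auto simp: \<Phi>_def indicator_def)
    moreover have "(\<Prod>k\<in>K. expectation (\<lambda>\<omega>. g k (Y n k \<omega>))) = (\<Prod>k\<in>K. \<integral>x. g k x \<partial>D)"
      using YD by (intro prod.cong) auto
    ultimately show ?thesis using K(1)
      by (subst prod.insert) (auto simp: \<Phi>_def prod.reindex)
  qed
  also have "expectation (\<lambda>\<omega>. of_real (indicator {j} (P n \<omega>)) :: 'b) = of_real (poisson_mass (rate n) j)"
    using integral_bounded_linear[OF bounded_linear_of_real, of M "\<lambda>\<omega>. indicator {j} (P n \<omega>)"] integrable_indicator_P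
    by (simp add: expectation_indicator_P)
  finally show "expectation (\<lambda>\<omega>. indicator {j} (P n \<omega>) *\<^sub>R (\<Prod>k\<in>K. g k (Y n k \<omega>)))
      = poisson_mass (rate n) j *\<^sub>R (\<Prod>k\<in>K. \<integral>x. g k x \<partial>D)"
    by (simp add: scaleR_conv_of_real)
qed

text \<open>The first m pieces add up to f on the event P_n < m, a sequence dominated by |f| and
  eventually equal to f.\<close>

lemma expectation_partition_P:
  fixes f :: "'a \<Rightarrow> 'b::{banach, second_countable_topology}"
  assumes f: "integrable M f"
  shows "(\<lambda>j. expectation (\<lambda>\<omega>. indicator {j} (P n \<omega>) *\<^sub>R f \<omega>)) sums expectation f"
proof -
  have [measurable]: "f \<in> borel_measurable M" using f by simp
  have i: "integrable M (\<lambda>\<omega>. indicator {j} (P n \<omega>) *\<^sub>R f \<omega>)" for j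
    by (rule Bochner_Integration.integrable_bound[OF f]) (auto simp: indicator_def)
  have eq: "(\<Sum>j<m. indicator {j} (P n \<omega>) *\<^sub>R f \<omega>) = (if P n \<omega> < m then f \<omega> else 0)" for m \<omega>
    by (simp add: indicator_P_scaleR sum.delta)
  have "(\<lambda>m. expectation (\<lambda>\<omega>. \<Sum>j<m. indicator {j} (P n \<omega>) *\<^sub>R f \<omega>)) \<longlonglongrightarrow> expectation f"
  proof (rule integral_dominated_convergence[where w="\<lambda>\<omega>. norm (f \<omega>)"])
    show "AE \<omega> in M. (\<lambda>m. \<Sum>j<m. indicator {j} (P n \<omega>) *\<^sub>R f \<omega>) \<longlonglongrightarrow> f \<omega>"
    proof (rule AE_I2)
      fix \<omega>
      show "(\<lambda>m. \<Sum>j<m. indicator {j} (P n \<omega>) *\<^sub>R f \<omega>) \<longlonglongrightarrow> f \<omega>" unfolding eq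
        by (rule tendsto_eventually, rule eventually_mono[OF eventually_gt_at_top[of "P n \<omega>"]]) simp
    qed
  qed (use f in \<open>auto simp: eq\<close>)
  moreover have "expectation (\<lambda>\<omega>. \<Sum>j<m. indicator {j} (P n \<omega>) *\<^sub>R f \<omega>)
      = (\<Sum>j<m. expectation (\<lambda>\<omega>. indicator {j} (P n \<omega>) *\<^sub>R f \<omega>))" for m
    by (rule Bochner_Integration.integral_sum) (rule i)
  ultimately show ?thesis unfolding sums_def by (simp only:)
qed

text \<open>A converse for nonnegative f: summable pieces give integrability. It is what proves that
  jump sums are square integrable in the first place.\<close>

lemma integrable_partition_P:
  fixes f :: "'a \<Rightarrow> real"
  assumes nn: "\<And>\<omega>. 0 \<le> f \<omega>" and i: "\<And>j. integrable M (\<lambda>\<omega>. indicator {j} (P n \<omega>) *\<^sub>R f \<omega>)"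
    and s: "summable (\<lambda>j. expectation (\<lambda>\<omega>. indicator {j} (P n \<omega>) *\<^sub>R f \<omega>))"
  shows "integrable M f"
proof -
  have "AE x in M. 0 \<le> indicator {j} (P n x) *\<^sub>R f x" for j
    using nn by auto
  from AE_summable_if_summable_integral(2)[OF i this s]
  have "integrable M (\<lambda>\<omega>. \<Sum>j. indicator {j} (P n \<omega>) *\<^sub>R f \<omega>)" .
  moreover have "(\<Sum>j. indicator {j} (P n \<omega>) *\<^sub>R f \<omega>) = f \<omega>" for \<omega>
    using sums_single[of "P n \<omega>" "\<lambda>_. f \<omega>"] unfolding indicator_P_scaleR by (simp only: sums_iff)
  ultimately show ?thesis by (simp only:)
qed

text \<open>Given P_n = j, the square expands into j diagonal pairs, each contributing the second
  moment, and j (j - 1) off-diagonal pairs, each contributing the squared mean. Poisson factorial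
  moments then sum over j.\<close>

lemma expectation_jump_sum_square:
  "integrable M (\<lambda>\<omega>. (jump_sum n \<omega>)\<^sup>2)"
  "expectation (\<lambda>\<omega>. (jump_sum n \<omega>)\<^sup>2) = rate n * second_moment + (rate n)\<^sup>2 * mean\<^sup>2"
proof -
  let ?m = "\<lambda>i k. if i = k then second_moment else mean\<^sup>2"
  let ?f = "\<lambda>j \<omega>. indicator {j} (P n \<omega>) *\<^sub>R (jump_sum n \<omega>)\<^sup>2"
  have pair: "integrable M (\<lambda>\<omega>. indicator {j} (P n \<omega>) *\<^sub>R (Y n i \<omega> * Y n k \<omega>))"
    "expectation (\<lambda>\<omega>. indicator {j} (P n \<omega>) *\<^sub>R (Y n i \<omega> * Y n k \<omega>)) = poisson_mass (rate n) j * ?m i k"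
    if "i \<in> {1..j}" "k \<in> {1..j}" for i j k
  proof -
    consider "i = k" | "i \<noteq> k" by blast
    then have "integrable M (\<lambda>\<omega>. indicator {j} (P n \<omega>) *\<^sub>R (Y n i \<omega> * Y n k \<omega>)) \<and>
      expectation (\<lambda>\<omega>. indicator {j} (P n \<omega>) *\<^sub>R (Y n i \<omega> * Y n k \<omega>)) = poisson_mass (rate n) j * ?m i k"
    proof cases
      case 1
      then show ?thesis
        using expectation_fixed_number_of_jumps[of "{i}" "\<lambda>_ x. x\<^sup>2" j n] that D_square
        by (simp add: power2_eq_square)
    next
      case 2
      moreover have "1 \<le> k'" if "k' \<in> {i, k}" for k' using that \<open>i \<in> {1..j}\<close> \<open>k \<in> {1..j}\<close> by auto
      ultimately show ?thesis
        using expectation_fixed_number_of_jumps[of "{i, k}" "\<lambda>_ x. x" j n] integrable_D_id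
        by (simp add: power2_eq_square)
    qed
    then show "integrable M (\<lambda>\<omega>. indicator {j} (P n \<omega>) *\<^sub>R (Y n i \<omega> * Y n k \<omega>))"
    "expectation (\<lambda>\<omega>. indicator {j} (P n \<omega>) *\<^sub>R (Y n i \<omega> * Y n k \<omega>)) = poisson_mass (rate n) j * ?m i k"
      by auto
  qed
  have f_eq: "?f j \<omega> = (\<Sum>i=1..j. \<Sum>k=1..j. indicator {j} (P n \<omega>) *\<^sub>R (Y n i \<omega> * Y n k \<omega>))" for j \<omega>
    by (auto simp: jump_sum_def indicator_def power2_eq_square sum_product)
  have i: "integrable M (?f j)" for j
    unfolding f_eq by (intro Bochner_Integration.integrable_sum pair)
  have count: "(\<Sum>i=1..j. \<Sum>k=1..j. ?m i k) = real j * second_moment + real j * (real j - 1) * mean\<^sup>2" for j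
  proof -
    have "(\<Sum>k=1..j. ?m i k) = second_moment + (real j - 1) * mean\<^sup>2" if "i \<in> {1..j}" for i
    proof -
      have "(\<Sum>k\<in>{1..j} - {i}. ?m i k) = (\<Sum>k\<in>{1..j} - {i}. mean\<^sup>2)" by (intro sum.cong) auto
      then show ?thesis using that by (subst sum.remove[OF _ that]) (auto simp: of_nat_diff)
    qed
    then have "(\<Sum>i=1..j. \<Sum>k=1..j. ?m i k) = (\<Sum>i=1..j. second_moment + (real j - 1) * mean\<^sup>2)"
      by (intro sum.cong refl)
    then show ?thesis by (simp add: algebra_simps)
  qed
  have E: "expectation (?f j) = poisson_mass (rate n) j * real j * second_moment
      + poisson_mass (rate n) j * (real j * (real j - 1)) * mean\<^sup>2" for j
  proof -
    have "expectation (?f j) = (\<Sum>i=1..j. \<Sum>k=1..j. poisson_mass (rate n) j * ?m i k)"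
      unfolding f_eq
      by (subst Bochner_Integration.integral_sum, intro Bochner_Integration.integrable_sum pair, assumption+)
         (intro sum.cong refl, subst Bochner_Integration.integral_sum, rule pair, assumption+, intro sum.cong refl pair)
    also have "\<dots> = poisson_mass (rate n) j * (\<Sum>i=1..j. \<Sum>k=1..j. ?m i k)"
      by (simp only: sum_distrib_left)
    finally show ?thesis unfolding count by (simp add: algebra_simps)
  qed
  have sums: "(\<lambda>j. expectation (?f j)) sums (rate n * second_moment + (rate n)\<^sup>2 * mean\<^sup>2)"
    unfolding E by (intro sums_add sums_mult2 poisson_mass_factorial_moments)
  show int: "integrable M (\<lambda>\<omega>. (jump_sum n \<omega>)\<^sup>2)"
    by (rule integrable_partition_P[OF _ i sums_summable[OF sums]]) simp
  show "expectation (\<lambda>\<omega>. (jump_sum n \<omega>)\<^sup>2) = rate n * second_moment + (rate n)\<^sup>2 * mean\<^sup>2"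
    using expectation_partition_P[OF int] sums by (rule sums_unique2)
qed

lemma integrable_jump_sum: "integrable M (jump_sum n)"
  by (rule square_integrable_imp_integrable[OF _ expectation_jump_sum_square(1)]) simp

lemma expectation_jump_sum: "expectation (jump_sum n) = rate n * mean"
proof -
  let ?f = "\<lambda>j \<omega>. indicator {j} (P n \<omega>) *\<^sub>R jump_sum n \<omega>"
  have single: "integrable M (\<lambda>\<omega>. indicator {j} (P n \<omega>) *\<^sub>R Y n k \<omega>)"
    "expectation (\<lambda>\<omega>. indicator {j} (P n \<omega>) *\<^sub>R Y n k \<omega>) = poisson_mass (rate n) j * mean"
    if "k \<in> {1..j}" for j k
    using expectation_fixed_number_of_jumps[of "{k}" "\<lambda>_ x. x" j n] that integrable_D_id by auto
  have f_eq: "?f j \<omega> = (\<Sum>k=1..j. indicator {j} (P n \<omega>) *\<^sub>R Y n k \<omega>)" for j \<omega>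
    by (auto simp: jump_sum_def indicator_def)
  have "expectation (?f j) = poisson_mass (rate n) j * real j * mean" for j
  proof -
    have "expectation (?f j) = (\<Sum>k=1..j. poisson_mass (rate n) j * mean)"
      unfolding f_eq by (subst Bochner_Integration.integral_sum, rule single, assumption) (intro sum.cong refl single)
    then show ?thesis by simp
  qed
  then have "(\<lambda>j. expectation (?f j)) sums (rate n * mean)"
    using sums_mult2[OF poisson_mass_factorial_moments(2)] by simp
  then show ?thesis using sums_unique2[OF expectation_partition_P[OF integrable_jump_sum]] by blast
qed

text \<open>Centring removes exactly the squared-mean term, so the variance of a compound Poisson
  sum is governed by the raw second moment of a jump. This is why E V^2, not Var V, appears in the
  variance of S.\<close>

lemma variance_jump_sum:
  "integrable M (\<lambda>\<omega>. (jump_sum n \<omega> - rate n * mean)\<^sup>2)"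
  "expectation (\<lambda>\<omega>. (jump_sum n \<omega> - rate n * mean)\<^sup>2) = rate n * second_moment"
proof -
  have eq: "(jump_sum n \<omega> - rate n * mean)\<^sup>2 = (jump_sum n \<omega>)\<^sup>2 - 2 * (rate n * mean) * jump_sum n \<omega> + (rate n * mean)\<^sup>2" for \<omega>
    by (simp add: power2_diff)
  show "integrable M (\<lambda>\<omega>. (jump_sum n \<omega> - rate n * mean)\<^sup>2)"
    unfolding eq using integrable_jump_sum expectation_jump_sum_square(1) by simp
  show "expectation (\<lambda>\<omega>. (jump_sum n \<omega> - rate n * mean)\<^sup>2) = rate n * second_moment"
    unfolding eq using integrable_jump_sum expectation_jump_sum_square
    by (simp add: expectation_jump_sum prob_space) (simp add: power2_eq_square algebra_simps)
qed

lemma AE_Y: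
  assumes "AE x in D. Q x"
  shows "AE \<omega> in M. \<forall>n k. 1 \<le> k \<longrightarrow> Q (Y n k \<omega>)"
proof -
  have "AE \<omega> in M. 1 \<le> k \<longrightarrow> Q (Y n k \<omega>)" for n k
  proof (cases "1 \<le> k")
    case True
    have "AE x in distr M borel (Y n k). Q x" unfolding distr_Y[OF True] by (rule assms)
    then show ?thesis using AE_distrD[OF measurable_Y[OF True]] by auto
  qed simp
  then show ?thesis by (simp add: AE_all_countable)
qed

lemma AE_Re_jump_sum_nonpos:
  assumes "AE x in D. Re z * x \<le> 0"
  shows "AE \<omega> in M. \<forall>n. Re z * jump_sum n \<omega> \<le> 0"
  using AE_Y[OF assms] by eventually_elim (auto simp: jump_sum_def sum_distrib_left intro!: sum_nonpos)

text \<open>The Poisson generating function evaluated at E exp(z x). The sign condition bounds the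
  exponentials by 1; it holds for imaginary z with any jump law, and for negative real z with
  nonnegative jumps.\<close>

lemma expectation_exp_jump_sum:
  fixes z :: complex
  assumes z: "AE x in D. Re z * x \<le> 0"
  shows "expectation (\<lambda>\<omega>. exp (z * of_real (jump_sum n \<omega>)))
    = exp (of_real (rate n) * ((\<integral>x. exp (z * of_real x) \<partial>D) - 1))"
proof -
  have int: "integrable M (\<lambda>\<omega>. exp (z * of_real (jump_sum n \<omega>)))"
  proof (rule integrable_const_bound[where B=1])
    show "AE \<omega> in M. norm (exp (z * of_real (jump_sum n \<omega>))) \<le> 1"
      using AE_Re_jump_sum_nonpos[OF z] by eventually_elim simp
  qed simp
  have intD: "integrable D (\<lambda>x. exp (z * of_real x))"
  proof (rule D.integrable_const_bound[where B=1])
    show "AE x in D. norm (exp (z * of_real x)) \<le> 1" using z by eventually_elim simp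
  qed simp
  have eq: "indicator {j} (P n \<omega>) *\<^sub>R exp (z * of_real (jump_sum n \<omega>))
      = indicator {j} (P n \<omega>) *\<^sub>R (\<Prod>k\<in>{1..j}. exp (z * of_real (Y n k \<omega>)))" for j \<omega>
    by (auto simp: indicator_def jump_sum_def exp_sum[symmetric] sum_distrib_left)
  have "(\<lambda>j. of_real (poisson_mass (rate n) j) * (\<integral>x. exp (z * of_real x) \<partial>D) ^ j)
      sums expectation (\<lambda>\<omega>. exp (z * of_real (jump_sum n \<omega>)))"
    using expectation_partition_P[OF int, of n] unfolding eq
    using expectation_fixed_number_of_jumps(2)[of "{1.._}" "\<lambda>_ x. exp (z * of_real x)" _ n] intD
    by (simp add: scaleR_conv_of_real)
  then show ?thesis
    using sums_unique2[OF poisson_mass_generating_function] by metis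
qed

section \<open>Independent blocks and weighted tails\<close>

definition block :: "nat option \<Rightarrow> 'a \<Rightarrow> real" where
  "block i = (case i of None \<Rightarrow> X | Some n \<Rightarrow> jump_sum n)"

text \<open>Disjoint groups of an independent family are independent, and each block is a measurable
  function of its own group: \<open>None\<close> uses only X, while \<open>Some n\<close> uses P_n
  and all jumps of level n.\<close>

lemma indep_blocks: "indep_vars (\<lambda>_. borel) block UNIV"
proof -
  define K where "K i = (case i of None \<Rightarrow> {IX} | Some n \<Rightarrow> insert (IP n) {IY n k | k. 1 \<le> k})" for i
  \<comment> \<open>Rebuilds the block from its coordinates. The random upper limit is the real
    coordinate \<open>IP n\<close> turned back into a natural number; measurability follows by
    splitting over its countably many values.\<close>
  define \<Psi> where "\<Psi> i f = (case i of None \<Rightarrow> f IX | Some n \<Rightarrow> \<Sum>k = 1..nat \<lfloor>f (IP n)\<rfloor>. f (IY n k))"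
    for i and f :: "rv_idx \<Rightarrow> real"
  have "indep_vars (\<lambda>i. PiM (K i) (\<lambda>_. borel)) (\<lambda>i \<omega>. restrict (\<lambda>j. rv_family X Y P j \<omega>) (K i)) UNIV"
    by (rule indep_vars_restrict[OF indep])
       (auto simp: K_def disjoint_family_on_def split: option.splits)
  then have "indep_vars (\<lambda>_. borel) (\<lambda>i \<omega>. \<Psi> i (restrict (\<lambda>j. rv_family X Y P j \<omega>) (K i))) UNIV"
  proof (rule indep_vars_compose2)
    fix i :: "nat option"
    have "(\<lambda>f :: rv_idx \<Rightarrow> real. \<Sum>k = 1..nat \<lfloor>f (IP n)\<rfloor>. f (IY n k)) \<in> borel_measurable (PiM (K (Some n)) (\<lambda>_. borel))" for n
    proof (rule measurable_compose_countable[where f="\<lambda>j f. \<Sum>k = 1..j. f (IY n k)" and g="\<lambda>f. nat \<lfloor>f (IP n)\<rfloor>"])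
      show "(\<lambda>f :: rv_idx \<Rightarrow> real. \<Sum>k = 1..j. f (IY n k)) \<in> borel_measurable (PiM (K (Some n)) (\<lambda>_. borel))" for j
        by (intro borel_measurable_sum measurable_component_singleton) (auto simp: K_def)
      have [measurable]: "(\<lambda>f :: rv_idx \<Rightarrow> real. f (IP n)) \<in> borel_measurable (PiM (K (Some n)) (\<lambda>_. borel))"
        by (intro measurable_component_singleton) (auto simp: K_def)
      show "(\<lambda>f :: rv_idx \<Rightarrow> real. nat \<lfloor>f (IP n)\<rfloor>) \<in> PiM (K (Some n)) (\<lambda>_. borel) \<rightarrow>\<^sub>M count_space UNIV" by measurable
    qed
    then show "\<Psi> i \<in> borel_measurable (PiM (K i) (\<lambda>_. borel))"
      by (cases i) (auto simp: \<Psi>_def[abs_def] K_def)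
  qed
  also have "(\<lambda>i \<omega>. \<Psi> i (restrict (\<lambda>j. rv_family X Y P j \<omega>) (K i))) = block"
    by (auto simp: \<Psi>_def K_def block_def jump_sum_def fun_eq_iff split: option.splits intro!: sum.cong)
  finally show ?thesis .
qed

lemma indep_jump_sums: "indep_vars (\<lambda>_. borel) jump_sum UNIV"
proof -
  have "indep_vars (\<lambda>n. PiM {Some n} (\<lambda>_. borel)) (\<lambda>n \<omega>. restrict (\<lambda>i. block i \<omega>) {Some n}) UNIV"
    by (rule indep_vars_restrict[OF indep_blocks]) (auto simp: disjoint_family_on_def)
  then have "indep_vars (\<lambda>_. borel) (\<lambda>n \<omega>. restrict (\<lambda>i. block i \<omega>) {Some n} (Some n)) UNIV"
    by (rule indep_vars_compose2) (intro measurable_component_singleton, simp)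
  then show ?thesis by (simp add: block_def)
qed

text \<open>Levels start at N + 1, the first one omitted by the truncation. The ratio is 1/2 for the
  rescaled error T and 1/4 for the random variance S.\<close>

definition tail :: "real \<Rightarrow> nat \<Rightarrow> 'a \<Rightarrow> real" where
  "tail r N \<omega> = (\<Sum>n. r ^ (N + 1 + n) * jump_sum (N + 1 + n) \<omega>)"

lemma measurable_tail [measurable]: "tail r N \<in> borel_measurable M"
  unfolding tail_def[abs_def] by measurable

text \<open>The tail reads only levels above N, and the truncated expansion only X and levels up to
  N. The factors c and d are left free so that the second variable becomes A_N(h) for the right
  choice.\<close>

lemma indep_tail:
  "indep_var borel (tail r N) borel (\<lambda>\<omega>. c * (X \<omega> + (\<Sum>n=0..N. d n * jump_sum n \<omega>)))"
proof -
  let ?A = "Some ` {N<..}" and ?B = "insert None (Some ` {..N})"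
  let ?f = "\<lambda>g. \<Sum>n. r ^ (N + 1 + n) * g (Some (N + 1 + n))"
  let ?g = "\<lambda>g. c * (g None + (\<Sum>n=0..N. d n * g (Some n)))"
  have "indep_var (PiM ?A (\<lambda>_. borel)) (\<lambda>\<omega>. restrict (\<lambda>i. block i \<omega>) ?A)
     (PiM ?B (\<lambda>_. borel)) (\<lambda>\<omega>. restrict (\<lambda>i. block i \<omega>) ?B)"
    by (rule indep_var_restrict[OF indep_blocks]) auto
  then have "indep_var borel (?f \<circ> (\<lambda>\<omega>. restrict (\<lambda>i. block i \<omega>) ?A)) borel (?g \<circ> (\<lambda>\<omega>. restrict (\<lambda>i. block i \<omega>) ?B))"
  proof (rule indep_var_compose)
    have "(\<lambda>g. g (Some (N + 1 + n))) \<in> borel_measurable (PiM ?A (\<lambda>_. borel))" for n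
      by (intro measurable_component_singleton) auto
    then show "?f \<in> borel_measurable (PiM ?A (\<lambda>_. borel :: real measure))" by measurable
    show "?g \<in> borel_measurable (PiM ?B (\<lambda>_. borel :: real measure))"
      by (intro borel_measurable_times borel_measurable_add borel_measurable_sum
         borel_measurable_const measurable_component_singleton) auto
  qed
  also have "?f \<circ> (\<lambda>\<omega>. restrict (\<lambda>i. block i \<omega>) ?A) = tail r N"
    by (auto simp: fun_eq_iff tail_def block_def)
  also have "?g \<circ> (\<lambda>\<omega>. restrict (\<lambda>i. block i \<omega>) ?B) = (\<lambda>\<omega>. c * (X \<omega> + (\<Sum>n=0..N. d n * jump_sum n \<omega>)))"
    by (auto simp: fun_eq_iff block_def)
  finally show ?thesis .
qed

text \<open>The centred term of level n has variance r^(2n) b 2^n E x^2, geometric with ratio 2 r^2.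
  \<open>\<mu>\<close> is the mean of the tail: 0 for logistic jumps, positive for the mixing jumps
  when b > 0.\<close>

lemma tail_L2:
  assumes r: "0 < r" "r \<le> 1/2" and s: "(\<lambda>n. r ^ (N + 1 + n) * (rate (N + 1 + n) * mean)) sums \<mu>"
  shows "AE \<omega> in M. summable (\<lambda>n. r ^ (N + 1 + n) * jump_sum (N + 1 + n) \<omega>)"
    and "integrable M (\<lambda>\<omega>. (tail r N \<omega> - \<mu>)\<^sup>2)"
    and "expectation (\<lambda>\<omega>. (tail r N \<omega> - \<mu>)\<^sup>2) = b * second_moment * (2 * r\<^sup>2) ^ (N + 1) / (1 - 2 * r\<^sup>2)"
proof -
  define q where "q = 2 * r\<^sup>2"
  have q: "0 < q" "q \<le> 1/2"
    using r power_mono[of r "1/2" 2] by (auto simp: q_def power2_eq_square)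
  define W where "W n \<omega> = r ^ (N + 1 + n) * (jump_sum (N + 1 + n) \<omega> - rate (N + 1 + n) * mean)" for n \<omega>
  define v where "v n = b * second_moment * q ^ (N + 1) * q ^ n" for n
  have [measurable]: "W n \<in> borel_measurable M" for n unfolding W_def[abs_def] by measurable
  have W2: "integrable M (\<lambda>\<omega>. (W n \<omega>)\<^sup>2)" for n
    unfolding W_def power_mult_distrib using variance_jump_sum(1) by simp
  have v: "expectation (\<lambda>\<omega>. (W n \<omega>)\<^sup>2) = v n" for n
  proof -
    have "expectation (\<lambda>\<omega>. (W n \<omega>)\<^sup>2) = (r\<^sup>2) ^ (N + 1 + n) * (rate (N + 1 + n) * second_moment)"
      unfolding W_def power_mult_distrib integral_mult_right_zero variance_jump_sum(2)
      by (simp only: power_mult[symmetric] mult.commute)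
    also have "\<dots> = v n" by (simp add: v_def q_def rate_def power_mult_distrib power_add)
    finally show ?thesis .
  qed
  \<comment> \<open>Centred independent variables are uncorrelated.\<close>
  have orth: "expectation (\<lambda>\<omega>. W m \<omega> * W n \<omega>) = 0" if "m \<noteq> n" for m n
  proof -
    have "indep_vars (\<lambda>_. borel) (\<lambda>n \<omega>. jump_sum n \<omega> - rate n * mean) {N + 1 + m, N + 1 + n}"
      by (rule indep_vars_compose2[OF indep_vars_subset[OF indep_jump_sums]]) auto
    then have "expectation (\<lambda>\<omega>. \<Prod>i\<in>{N + 1 + m, N + 1 + n}. jump_sum i \<omega> - rate i * mean)
      = (\<Prod>i\<in>{N + 1 + m, N + 1 + n}. expectation (\<lambda>\<omega>. jump_sum i \<omega> - rate i * mean))"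
      by (intro indep_vars_lebesgue_integral Bochner_Integration.integrable_diff integrable_jump_sum
          integrable_const) simp_all
    also have "\<dots> = 0"
    proof -
      have "expectation (\<lambda>\<omega>. jump_sum i \<omega> - rate i * mean) = 0" for i
        using integrable_jump_sum by (simp add: expectation_jump_sum prob_space)
      then show ?thesis by (intro prod_zero) auto
    qed
    finally have "expectation (\<lambda>\<omega>. (jump_sum (N + 1 + m) \<omega> - rate (N + 1 + m) * mean) * (jump_sum (N + 1 + n) \<omega> - rate (N + 1 + n) * mean)) = 0"
      using that by simp
    then have "expectation (\<lambda>\<omega>. (r ^ (N + 1 + m) * r ^ (N + 1 + n)) * ((jump_sum (N + 1 + m) \<omega> - rate (N + 1 + m) * mean) * (jump_sum (N + 1 + n) \<omega> - rate (N + 1 + n) * mean))) = 0"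
      by (subst integral_mult_right_zero) simp
    then show ?thesis by (simp add: W_def mult_ac)
  qed
  \<comment> \<open>Any weight ratio strictly between q and 1 would do; with q <= 1/2 the choice 3/4
    leaves the convergent ratio q / (3/4) <= 2/3.\<close>
  have "summable (\<lambda>n. b * second_moment * q ^ (N + 1) * (q / (3/4)) ^ n)"
    using q by (intro summable_mult summable_geometric) auto
  then have vc: "summable (\<lambda>n. v n / (3/4) ^ n)" by (simp only: v_def power_divide times_divide_eq_right)
  note O = orthogonal_series[of W M v "\<lambda>n. (3/4) ^ n", OF _ W2 v orth _ _ vc]
  have sW: "AE \<omega> in M. summable (\<lambda>n. W n \<omega>)" by (rule O(1)) (auto intro!: summable_geometric)
  have W_eq: "r ^ (N + 1 + n) * jump_sum (N + 1 + n) \<omega> = W n \<omega> + r ^ (N + 1 + n) * (rate (N + 1 + n) * mean)" for n \<omega>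
    by (simp add: W_def algebra_simps)
  show "AE \<omega> in M. summable (\<lambda>n. r ^ (N + 1 + n) * jump_sum (N + 1 + n) \<omega>)"
    using sW unfolding W_eq by eventually_elim (intro summable_add sums_summable[OF s])
  have tail_eq: "AE \<omega> in M. (tail r N \<omega> - \<mu>)\<^sup>2 = (\<Sum>n. W n \<omega>)\<^sup>2"
    using sW
  proof eventually_elim
    case (elim \<omega>)
    have "tail r N \<omega> = (\<Sum>n. W n \<omega>) + \<mu>"
      unfolding tail_def W_eq using suminf_add[OF elim sums_summable[OF s]] s by (simp only: sums_iff)
    then show ?case by simp
  qed
  have intW: "integrable M (\<lambda>\<omega>. (\<Sum>n. W n \<omega>)\<^sup>2)" by (rule O(2)) (auto intro!: summable_geometric)
  show "integrable M (\<lambda>\<omega>. (tail r N \<omega> - \<mu>)\<^sup>2)"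
    by (rule integrable_cong_AE_imp[OF intW _ tail_eq[THEN AE_symmetric]]) measurable
  have "expectation (\<lambda>\<omega>. (tail r N \<omega> - \<mu>)\<^sup>2) = expectation (\<lambda>\<omega>. (\<Sum>n. W n \<omega>)\<^sup>2)"
    by (rule integral_cong_AE[OF _ _ tail_eq]) measurable
  also have "v sums \<dots>" by (rule O(3)) (auto intro!: summable_geometric)
  moreover have "v sums (b * second_moment * q ^ (N + 1) * (1 / (1 - q)))"
    unfolding v_def using q by (intro sums_mult geometric_sums) auto
  ultimately show "expectation (\<lambda>\<omega>. (tail r N \<omega> - \<mu>)\<^sup>2) = b * second_moment * (2 * r\<^sup>2) ^ (N + 1) / (1 - 2 * r\<^sup>2)"
    unfolding q_def[symmetric] by (auto dest: sums_unique2)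
qed

text \<open>Independence of levels gives the partial products, and the bound 1 on the exponentials
  allows the limit. It is kept as a limit of partial products because the two transforms are later
  matched factor by factor.\<close>

lemma expectation_exp_tail:
  fixes z :: complex
  assumes r: "0 < r" and z: "AE x in D. Re z * x \<le> 0"
    and s: "AE \<omega> in M. summable (\<lambda>n. r ^ (N + 1 + n) * jump_sum (N + 1 + n) \<omega>)"
  shows "(\<lambda>m. \<Prod>n<m. exp (of_real (rate (N + 1 + n)) * ((\<integral>x. exp (z * of_real (r ^ (N + 1 + n)) * of_real x) \<partial>D) - 1)))
    \<longlonglongrightarrow> expectation (\<lambda>\<omega>. exp (z * of_real (tail r N \<omega>)))"
proof -
  let ?S = "\<lambda>m \<omega>. \<Sum>n<m. r ^ (N + 1 + n) * jump_sum (N + 1 + n) \<omega>"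
  have "expectation (\<lambda>\<omega>. exp (z * of_real (?S m \<omega>)))
     = (\<Prod>n<m. exp (of_real (rate (N + 1 + n)) * ((\<integral>x. exp (z * of_real (r ^ (N + 1 + n)) * of_real x) \<partial>D) - 1)))" for m
  proof -
    let ?I = "(\<lambda>n. N + 1 + n) ` {..<m}"
    have inj: "inj_on (\<lambda>n. N + 1 + n) {..<m}" by (simp add: inj_on_def)
    have ind: "indep_vars (\<lambda>_. borel) (\<lambda>n \<omega>. exp (z * of_real (r ^ n) * of_real (jump_sum n \<omega>))) ?I"
      by (rule indep_vars_compose2[OF indep_vars_subset[OF indep_jump_sums]]) auto
    have zr: "AE x in D. Re (z * of_real (r ^ n)) * x \<le> 0" for n
      using z
    proof eventually_elim
      case (elim x)
      then have "r ^ n * (Re z * x) \<le> 0" using r by (simp add: mult_nonneg_nonpos)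
      then show ?case by (simp add: mult_ac)
    qed
    have "expectation (\<lambda>\<omega>. exp (z * of_real (?S m \<omega>)))
      = expectation (\<lambda>\<omega>. \<Prod>n\<in>?I. exp (z * of_real (r ^ n) * of_real (jump_sum n \<omega>)))"
      by (simp only: prod.reindex[OF inj] o_def) (simp add: exp_sum sum_distrib_left mult.assoc)
    also have "\<dots> = (\<Prod>n\<in>?I. expectation (\<lambda>\<omega>. exp (z * of_real (r ^ n) * of_real (jump_sum n \<omega>))))"
    proof (rule indep_vars_lebesgue_integral[OF _ ind])
      fix n
      show "integrable M (\<lambda>\<omega>. exp (z * of_real (r ^ n) * of_real (jump_sum n \<omega>)))"
      proof (rule integrable_const_bound[where B=1])
        show "AE \<omega> in M. norm (exp (z * of_real (r ^ n) * of_real (jump_sum n \<omega>))) \<le> 1"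
          using AE_Re_jump_sum_nonpos[OF zr[of n]] by eventually_elim simp
      qed simp
    qed simp
    also have "\<dots> = (\<Prod>n\<in>?I. exp (of_real (rate n) * ((\<integral>x. exp (z * of_real (r ^ n) * of_real x) \<partial>D) - 1)))"
      by (intro prod.cong refl expectation_exp_jump_sum zr)
    finally show ?thesis by (simp only: prod.reindex[OF inj] o_def)
  qed
  moreover have "(\<lambda>m. expectation (\<lambda>\<omega>. exp (z * of_real (?S m \<omega>)))) \<longlonglongrightarrow> expectation (\<lambda>\<omega>. exp (z * of_real (tail r N \<omega>)))"
  proof (rule integral_dominated_convergence[where w="\<lambda>_. 1"])
    show "AE \<omega> in M. (\<lambda>m. exp (z * of_real (?S m \<omega>))) \<longlonglongrightarrow> exp (z * of_real (tail r N \<omega>))"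
      using s unfolding tail_def
      by eventually_elim (intro tendsto_exp tendsto_mult tendsto_const tendsto_of_real summable_LIMSEQ)
    show "AE \<omega> in M. norm (exp (z * of_real (?S m \<omega>))) \<le> 1" for m
      using AE_Re_jump_sum_nonpos[OF z]
    proof eventually_elim
      case (elim \<omega>)
      have "Re z * ?S m \<omega> = (\<Sum>n<m. r ^ (N + 1 + n) * (Re z * jump_sum (N + 1 + n) \<omega>))"
        by (simp add: sum_distrib_left mult_ac)
      also have "\<dots> \<le> 0" by (intro sum_nonpos, rule mult_nonneg_nonpos) (use elim r in auto)
      finally show ?case by simp
    qed
  qed auto
  ultimately show ?thesis by simp
qed

end

section \<open>Coupling with a normal variable\<close>

lemma nn_integral_normal_density_scale:
  fixes F :: "real \<Rightarrow> ennreal"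
  assumes [measurable]: "F \<in> borel_measurable borel" and s: "0 < s"
  shows "(\<integral>\<^sup>+t. F t * ennreal (normal_density 0 (sqrt s) t) \<partial>lborel) = (\<integral>\<^sup>+z. F (sqrt s * z) \<partial>std_normal_distribution)"
proof -
  have "(\<integral>\<^sup>+t. F t * ennreal (normal_density 0 (sqrt s) t) \<partial>lborel)
     = ennreal \<bar>sqrt s\<bar> * (\<integral>\<^sup>+z. F (0 + sqrt s * z) * ennreal (normal_density 0 (sqrt s) (0 + sqrt s * z)) \<partial>lborel)"
    using s by (intro nn_integral_real_affine) auto
  also have "\<dots> = (\<integral>\<^sup>+z. ennreal (sqrt s) * (F (sqrt s * z) * ennreal (normal_density 0 (sqrt s) (sqrt s * z))) \<partial>lborel)"
    using s by (subst nn_integral_cmult) auto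
  also have "\<dots> = (\<integral>\<^sup>+z. ennreal (std_normal_density z) * F (sqrt s * z) \<partial>lborel)"
  proof (rule nn_integral_cong)
    fix z
    have "sqrt s * normal_density 0 (sqrt s) (sqrt s * z) = std_normal_density z"
      using s by (simp add: normal_density_def real_sqrt_mult power_mult_distrib)
    then have "ennreal (sqrt s) * ennreal (normal_density 0 (sqrt s) (sqrt s * z)) = ennreal (std_normal_density z)"
      using s by (subst ennreal_mult[symmetric]) auto
    then show "ennreal (sqrt s) * (F (sqrt s * z) * ennreal (normal_density 0 (sqrt s) (sqrt s * z)))
        = ennreal (std_normal_density z) * F (sqrt s * z)"
      by (metis mult.left_commute mult.commute)
  qed
  also have "\<dots> = (\<integral>\<^sup>+z. F (sqrt s * z) \<partial>std_normal_distribution)"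
    by (subst nn_integral_density) auto
  finally show ?thesis .
qed

definition gauss_mixture_density :: "real measure \<Rightarrow> real \<Rightarrow> ennreal" where
  "gauss_mixture_density \<mu> t = (\<integral>\<^sup>+s. ennreal (normal_density 0 (sqrt s) t) \<partial>\<mu>)"

lemma measurable_normal_density_scale [measurable]:
  "(\<lambda>p. normal_density 0 (sqrt (fst p)) (snd p)) \<in> borel_measurable (borel \<Otimes>\<^sub>M borel)"
  unfolding normal_density_def by measurable

lemma measurable_normal_density_scale' [measurable (raw)]:
  assumes "f \<in> borel_measurable M" "g \<in> borel_measurable M"
  shows "(\<lambda>x. normal_density 0 (sqrt (f x)) (g x)) \<in> borel_measurable M"
  using measurable_compose[OF measurable_Pair[OF assms] measurable_normal_density_scale] by simp

text \<open>Tonelli and the substitution t = sqrt s z; positivity of s excludes an atom at 0. The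
  last two facts make division by the mixture density legitimate: it is almost everywhere finite,
  and nowhere zero since normal densities are positive.\<close>

lemma gauss_mixture_eq_density:
  assumes mu: "real_distribution \<mu>" and pos: "AE s in \<mu>. 0 < s"
  shows "gauss_mixture \<mu> = density lborel (gauss_mixture_density \<mu>)"
    and "gauss_mixture_density \<mu> \<in> borel_measurable borel"
    and "AE t in lborel. gauss_mixture_density \<mu> t \<noteq> \<infinity>"
    and "gauss_mixture_density \<mu> t \<noteq> 0"
proof -
  interpret mu: real_distribution \<mu> by fact
  interpret N: real_distribution std_normal_distribution by (rule real_dist_normal_dist)
  interpret L: sigma_finite_measure lborel by (rule sigma_finite_lborel)
  interpret PL: pair_sigma_finite \<mu> lborel ..
  interpret G: real_distribution "gauss_mixture \<mu>" by (rule real_distribution_gauss_mixture[OF mu])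
  show fm[measurable]: "gauss_mixture_density \<mu> \<in> borel_measurable borel"
    unfolding gauss_mixture_density_def[abs_def] by measurable
  have key: "(\<integral>\<^sup>+x. F x \<partial>gauss_mixture \<mu>) = (\<integral>\<^sup>+t. gauss_mixture_density \<mu> t * F t \<partial>lborel)"
    if [measurable]: "F \<in> borel_measurable borel" for F
  proof -
    have "(\<integral>\<^sup>+x. F x \<partial>gauss_mixture \<mu>) = (\<integral>\<^sup>+p. F (sqrt (fst p) * snd p) \<partial>(\<mu> \<Otimes>\<^sub>M std_normal_distribution))"
      unfolding gauss_mixture_def by (subst nn_integral_distr) (auto simp: case_prod_unfold)
    also have "\<dots> = (\<integral>\<^sup>+s. \<integral>\<^sup>+z. F (sqrt s * z) \<partial>std_normal_distribution \<partial>\<mu>)"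
      by (subst N.nn_integral_fst[symmetric]) auto
    also have "\<dots> = (\<integral>\<^sup>+s. \<integral>\<^sup>+t. F t * ennreal (normal_density 0 (sqrt s) t) \<partial>lborel \<partial>\<mu>)"
      using pos by (intro nn_integral_cong_AE) (auto elim!: eventually_mono simp: nn_integral_normal_density_scale)
    also have "\<dots> = (\<integral>\<^sup>+t. \<integral>\<^sup>+s. F t * ennreal (normal_density 0 (sqrt s) t) \<partial>\<mu> \<partial>lborel)"
      by (rule PL.Fubini'[symmetric]) measurable
    also have "\<dots> = (\<integral>\<^sup>+t. gauss_mixture_density \<mu> t * F t \<partial>lborel)"
      unfolding gauss_mixture_density_def by (subst nn_integral_cmult) (auto simp: mult.commute)
    finally show ?thesis .
  qed
  show "gauss_mixture \<mu> = density lborel (gauss_mixture_density \<mu>)"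
  proof (rule measure_eqI)
    fix B assume "B \<in> sets (gauss_mixture \<mu>)"
    then have [measurable]: "B \<in> sets borel" by simp
    show "emeasure (gauss_mixture \<mu>) B = emeasure (density lborel (gauss_mixture_density \<mu>)) B"
      using key[of "indicator B"] by (simp add: emeasure_density)
  qed simp
  have "(\<integral>\<^sup>+t. gauss_mixture_density \<mu> t \<partial>lborel) = 1"
    using key[of "\<lambda>_. 1"] G.emeasure_space_1 by simp
  then show "AE t in lborel. gauss_mixture_density \<mu> t \<noteq> \<infinity>"
    by (intro nn_integral_PInf_AE) auto
  show "gauss_mixture_density \<mu> t \<noteq> 0"
  proof
    assume "gauss_mixture_density \<mu> t = 0"
    then have "AE s in \<mu>. ennreal (normal_density 0 (sqrt s) t) = 0"
      unfolding gauss_mixture_density_def by (subst (asm) nn_integral_0_iff_AE) auto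
    with pos have "AE s in \<mu>. False"
    proof eventually_elim
      case (elim s)
      then show ?case using normal_density_pos[of "sqrt s" 0 t] by (simp add: ennreal_eq_0_iff)
    qed
    then show False by simp
  qed
qed

text \<open>The density \<^term>\<open>w\<close> below is the posterior density, with respect to \<^term>\<open>\<mu>\<close>, of the
  scale given the value of \<^term>\<open>T\<close>.\<close>

lemma gauss_mixture_extension:
  fixes M :: "'a measure" and T A :: "'a \<Rightarrow> real"
  assumes M: "prob_space M" and ind: "prob_space.indep_var M borel T borel A"
    and mu: "real_distribution \<mu>" and pos: "AE s in \<mu>. 0 < s"
    and law: "distr M borel T = gauss_mixture \<mu>"
  obtains M' :: "('a \<times> real) measure" and Z where
    "prob_space M'" "fst \<in> M' \<rightarrow>\<^sub>M M" "distr M' M fst = M"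
    "distributed M' lborel Z (\<lambda>x. ennreal (std_normal_density x))"
    "prob_space.indep_var M' borel Z borel (\<lambda>x. A (fst x))"
    "\<And>H. H \<in> borel_measurable (borel \<Otimes>\<^sub>M borel) \<Longrightarrow>
      (\<integral>\<^sup>+x. H (T (fst x), Z x) \<partial>M') = (\<integral>\<^sup>+s. \<integral>\<^sup>+z. H (sqrt s * z, z) \<partial>std_normal_distribution \<partial>\<mu>)"
proof -
  interpret M: prob_space M by fact
  interpret mu: real_distribution \<mu> by fact
  interpret N: real_distribution std_normal_distribution by (rule real_dist_normal_dist)
  interpret MM: pair_prob_space M \<mu> ..
  define f where "f = gauss_mixture_density \<mu>"
  note f = gauss_mixture_eq_density[OF mu pos, folded f_def]
  note f(2)[measurable]
  have [measurable]: "T \<in> borel_measurable M" "A \<in> borel_measurable M"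
    using ind by (auto dest: M.indep_var_rv1 M.indep_var_rv2)
  define \<alpha> where "\<alpha> = distr M borel A"
  have al: "real_distribution \<alpha>" unfolding \<alpha>_def by (rule M.real_distribution_distr) simp
  interpret al: real_distribution \<alpha> by fact
  have joint: "density lborel f \<Otimes>\<^sub>M \<alpha> = distr M (borel \<Otimes>\<^sub>M borel) (\<lambda>\<omega>. (T \<omega>, A \<omega>))"
    using ind law f(1) unfolding M.indep_var_distribution_eq \<alpha>_def by simp
  interpret F: prob_space "density lborel f"
    using mu law f(1) real_distribution_gauss_mixture by (metis real_distribution_def)
  interpret FA: pair_prob_space "density lborel f" \<alpha> ..
  define w where "w p = ennreal (normal_density 0 (sqrt (snd p)) (T (fst p))) / f (T (fst p))" for p
  have [measurable]: "w \<in> borel_measurable (M \<Otimes>\<^sub>M \<mu>)" unfolding w_def[abs_def] by measurable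
  define M' where "M' = density (M \<Otimes>\<^sub>M \<mu>) w"
  define Z where "Z p = T (fst p) / sqrt (snd p)" for p :: "'a \<times> real"
  have sets_M'[measurable_cong]: "sets M' = sets (M \<Otimes>\<^sub>M \<mu>)" by (simp add: M'_def)
  have [measurable]: "Z \<in> borel_measurable M'" "Z \<in> borel_measurable (M \<Otimes>\<^sub>M \<mu>)"
    unfolding Z_def[abs_def] by measurable
  \<comment> \<open>In \<open>ennreal\<close> this cancellation needs both f t nonzero, true
    everywhere, and f t finite, true almost everywhere.\<close>
  have cancel: "f t * (x / f t) = x" if "f t \<noteq> \<infinity>" for t x
    using that f(4)[of t] by (simp add: ennreal_times_divide mult_divide_eq_ennreal mult.commute)
  have fin: "AE \<omega> in M. f (T \<omega>) \<noteq> \<infinity>"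
  proof -
    have "AE t in distr M borel T. f t \<noteq> \<infinity>"
      unfolding law f(1) using f(3) by (subst AE_density) (auto elim!: eventually_mono)
    then show ?thesis by (subst (asm) AE_distr_iff) auto
  qed
  \<comment> \<open>Integrating the posterior density over the scale gives f / f = 1, so the new
    space really extends the old one.\<close>
  have proj: "distr M' M fst = M"
  proof (rule measure_eqI)
    fix B assume "B \<in> sets (distr M' M fst)"
    then have [measurable]: "B \<in> sets M" by simp
    have "emeasure (distr M' M fst) B = (\<integral>\<^sup>+p. indicator B (fst p) \<partial>M')"
      by (subst nn_integral_indicator[symmetric], simp, subst nn_integral_distr) simp_all
    also have "\<dots> = (\<integral>\<^sup>+p. w p * indicator B (fst p) \<partial>(M \<Otimes>\<^sub>M \<mu>))"
      unfolding M'_def by (rule nn_integral_density) measurable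
    also have "\<dots> = (\<integral>\<^sup>+\<omega>. \<integral>\<^sup>+s. w (\<omega>, s) * indicator B \<omega> \<partial>\<mu> \<partial>M)"
      by (subst mu.nn_integral_fst[symmetric]) simp_all
    also have "\<dots> = (\<integral>\<^sup>+\<omega>. indicator B \<omega> \<partial>M)"
    proof (rule nn_integral_cong_AE)
      show "AE \<omega> in M. (\<integral>\<^sup>+s. w (\<omega>, s) * indicator B \<omega> \<partial>\<mu>) = indicator B \<omega>"
        using fin
      proof eventually_elim
        case (elim \<omega>)
        have "(\<integral>\<^sup>+s. w (\<omega>, s) * indicator B \<omega> \<partial>\<mu>)
          = (\<integral>\<^sup>+s. ennreal (normal_density 0 (sqrt s) (T \<omega>)) / f (T \<omega>) \<partial>\<mu>) * indicator B \<omega>"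
          unfolding w_def by (subst nn_integral_multc) simp_all
        also have "(\<integral>\<^sup>+s. ennreal (normal_density 0 (sqrt s) (T \<omega>)) / f (T \<omega>) \<partial>\<mu>) = f (T \<omega>) / f (T \<omega>)"
          unfolding f_def gauss_mixture_density_def by (rule nn_integral_divide) simp
        also have "\<dots> = 1" using elim f(4)[of "T \<omega>"] by (intro ennreal_divide_self) (auto simp: less_top)
        finally show ?case by simp
      qed
    qed
    finally show "emeasure (distr M' M fst) B = emeasure M B" by simp
  qed simp
  have fst_meas: "fst \<in> M' \<rightarrow>\<^sub>M M" by simp
  have M'_prob: "prob_space M'"
    using proj M prob_space_distrD[OF fst_meas] by simp
  interpret M': prob_space M' by fact
  \<comment> \<open>The joint law of A, T and Z: scale, A and z become independent with laws
    \<open>\<mu>\<close>, \<open>\<alpha>\<close> and standard normal, and T = sqrt s z. For fixed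
    s, the law f of T cancels the denominator of the posterior, leaving the normal density of
    variance s; substituting t = sqrt s z turns t / sqrt s into z.\<close>
  have master: "(\<integral>\<^sup>+p. G (A (fst p)) (T (fst p)) (Z p) \<partial>M')
      = (\<integral>\<^sup>+s. \<integral>\<^sup>+x. \<integral>\<^sup>+z. G x (sqrt s * z) z \<partial>std_normal_distribution \<partial>\<alpha> \<partial>\<mu>)"
    if [measurable]: "(\<lambda>(x, t, z). G x t z) \<in> borel_measurable (borel \<Otimes>\<^sub>M borel \<Otimes>\<^sub>M borel)" for G
  proof -
    have [measurable]: "(\<lambda>x. G (f1 x) (f2 x) (f3 x)) \<in> borel_measurable K"
      if "f1 \<in> borel_measurable K" "f2 \<in> borel_measurable K" "f3 \<in> borel_measurable K" for f1 f2 f3 and K :: "'c measure"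
      using measurable_compose[OF measurable_Pair[OF that(1) measurable_Pair[OF that(2,3)]]
         \<open>(\<lambda>(x, t, z). G x t z) \<in> borel_measurable (borel \<Otimes>\<^sub>M borel \<Otimes>\<^sub>M borel)\<close>] by simp
    have G3[measurable]: "(\<lambda>p. G (fst p) (snd p) (snd p / sqrt s)) \<in> borel_measurable (borel \<Otimes>\<^sub>M borel)" for s
      by measurable
    have "(\<integral>\<^sup>+p. G (A (fst p)) (T (fst p)) (Z p) \<partial>M')
      = (\<integral>\<^sup>+p. w p * G (A (fst p)) (T (fst p)) (Z p) \<partial>(M \<Otimes>\<^sub>M \<mu>))"
      unfolding M'_def by (rule nn_integral_density) measurable
    also have "\<dots> = (\<integral>\<^sup>+s. \<integral>\<^sup>+\<omega>. w (\<omega>, s) * G (A \<omega>) (T \<omega>) (T \<omega> / sqrt s) \<partial>M \<partial>\<mu>)"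
      by (subst MM.nn_integral_snd[symmetric]) (simp_all add: Z_def)
    also have "\<dots> = (\<integral>\<^sup>+s. \<integral>\<^sup>+x. \<integral>\<^sup>+z. G x (sqrt s * z) z \<partial>std_normal_distribution \<partial>\<alpha> \<partial>\<mu>)"
    proof (rule nn_integral_cong_AE, rule AE_mp[OF pos], rule AE_I2, rule impI)
      fix s :: real assume s: "0 < s"
      let ?g = "\<lambda>x t. ennreal (normal_density 0 (sqrt s) t) / f t * G x t (t / sqrt s)"
      have "(\<integral>\<^sup>+\<omega>. w (\<omega>, s) * G (A \<omega>) (T \<omega>) (T \<omega> / sqrt s) \<partial>M)
         = (\<integral>\<^sup>+p. ?g (snd p) (fst p) \<partial>distr M (borel \<Otimes>\<^sub>M borel) (\<lambda>\<omega>. (T \<omega>, A \<omega>)))"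
        by (subst nn_integral_distr) (simp_all add: w_def)
      also have "\<dots> = (\<integral>\<^sup>+x. \<integral>\<^sup>+t. ?g x t \<partial>density lborel f \<partial>\<alpha>)"
        unfolding joint[symmetric] by (subst FA.nn_integral_snd[symmetric]) simp_all
      also have "\<dots> = (\<integral>\<^sup>+x. \<integral>\<^sup>+z. G x (sqrt s * z) z \<partial>std_normal_distribution \<partial>\<alpha>)"
      proof (rule nn_integral_cong)
        fix x
        have "(\<integral>\<^sup>+t. ?g x t \<partial>density lborel f) = (\<integral>\<^sup>+t. f t * ?g x t \<partial>lborel)"
          by (rule nn_integral_density) measurable
        also have "\<dots> = (\<integral>\<^sup>+t. G x t (t / sqrt s) * ennreal (normal_density 0 (sqrt s) t) \<partial>lborel)"
        proof (rule nn_integral_cong_AE)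
          show "AE t in lborel. f t * ?g x t = G x t (t / sqrt s) * ennreal (normal_density 0 (sqrt s) t)"
            using f(3)
          proof eventually_elim
            case (elim t)
            show ?case by (simp only: mult.assoc[symmetric] cancel[OF elim]) (rule mult.commute)
          qed
        qed
        also have "\<dots> = (\<integral>\<^sup>+z. G x (sqrt s * z) (sqrt s * z / sqrt s) \<partial>std_normal_distribution)"
          by (rule nn_integral_normal_density_scale[OF _ s]) measurable
        finally show "(\<integral>\<^sup>+t. ?g x t \<partial>density lborel f) = (\<integral>\<^sup>+z. G x (sqrt s * z) z \<partial>std_normal_distribution)"
          using s by simp
      qed
      finally show "(\<integral>\<^sup>+\<omega>. w (\<omega>, s) * G (A \<omega>) (T \<omega>) (T \<omega> / sqrt s) \<partial>M)
        = (\<integral>\<^sup>+x. \<integral>\<^sup>+z. G x (sqrt s * z) z \<partial>std_normal_distribution \<partial>\<alpha>)" .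
    qed
    finally show ?thesis .
  qed
  interpret NA: pair_prob_space std_normal_distribution \<alpha> ..
  \<comment> \<open>Test functions of z and x alone make the integral over the scale trivial, so the
    pair (Z, A) has a product law.\<close>
  have joint': "distr M' (borel \<Otimes>\<^sub>M borel) (\<lambda>p. (Z p, A (fst p))) = std_normal_distribution \<Otimes>\<^sub>M \<alpha>"
  proof (rule measure_eqI)
    fix B assume "B \<in> sets (distr M' (borel \<Otimes>\<^sub>M borel) (\<lambda>p. (Z p, A (fst p))))"
    then have [measurable]: "B \<in> sets (borel \<Otimes>\<^sub>M borel)" by simp
    have [measurable]: "B \<in> sets (std_normal_distribution \<Otimes>\<^sub>M \<alpha>)"
      using sets_pair_measure_cong[of std_normal_distribution borel \<alpha> borel] by simp
    have "emeasure (distr M' (borel \<Otimes>\<^sub>M borel) (\<lambda>p. (Z p, A (fst p)))) B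
       = (\<integral>\<^sup>+p. indicator B (Z p, A (fst p)) \<partial>M')"
      by (subst nn_integral_indicator[symmetric], simp, subst nn_integral_distr) simp_all
    also have "\<dots> = (\<integral>\<^sup>+s. \<integral>\<^sup>+x. \<integral>\<^sup>+z. indicator B (z, x) \<partial>std_normal_distribution \<partial>\<alpha> \<partial>\<mu>)"
      by (rule master[of "\<lambda>x t z. indicator B (z, x)"]) measurable
    also have "\<dots> = (\<integral>\<^sup>+x. \<integral>\<^sup>+z. indicator B (z, x) \<partial>std_normal_distribution \<partial>\<alpha>)"
      using mu.emeasure_space_1 by simp
    also have "\<dots> = (\<integral>\<^sup>+p. indicator B p \<partial>(std_normal_distribution \<Otimes>\<^sub>M \<alpha>))"
      by (subst NA.nn_integral_snd[symmetric]) simp_all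
    finally show "emeasure (distr M' (borel \<Otimes>\<^sub>M borel) (\<lambda>p. (Z p, A (fst p)))) B
        = emeasure (std_normal_distribution \<Otimes>\<^sub>M \<alpha>) B" by simp
  qed (simp add: sets_pair_measure_cong[of std_normal_distribution borel \<alpha> borel])
  have Z_law: "distr M' borel Z = std_normal_distribution"
  proof -
    have "distr M' borel Z = distr (distr M' (borel \<Otimes>\<^sub>M borel) (\<lambda>p. (Z p, A (fst p)))) borel fst"
      by (subst distr_distr) (simp_all add: o_def)
    also have "\<dots> = distr (std_normal_distribution \<Otimes>\<^sub>M \<alpha>) std_normal_distribution fst"
      unfolding joint' by (rule distr_cong) simp_all
    also have "\<dots> = std_normal_distribution" by (rule al.distr_pair_fst)
    finally show ?thesis .
  qed
  have A_law: "distr M' borel (\<lambda>p. A (fst p)) = \<alpha>"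
    using distr_distr[of A M borel fst M'] proj by (simp add: o_def \<alpha>_def)
  have "M'.indep_var borel Z borel (\<lambda>p. A (fst p))"
    unfolding M'.indep_var_distribution_eq by (simp add: Z_law A_law joint')
  moreover have "distributed M' lborel Z (\<lambda>x. ennreal (std_normal_density x))"
    unfolding distributed_def
    using Z_law by (auto cong: distr_cong)
  moreover have "(\<integral>\<^sup>+p. H (T (fst p), Z p) \<partial>M') = (\<integral>\<^sup>+s. \<integral>\<^sup>+z. H (sqrt s * z, z) \<partial>std_normal_distribution \<partial>\<mu>)"
    if [measurable]: "H \<in> borel_measurable (borel \<Otimes>\<^sub>M borel)" for H
    using master[of "\<lambda>x t z. H (t, z)"] al.emeasure_space_1 by simp
  ultimately show thesis using that M'_prob fst_meas proj by blast
qed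

text \<open>Builds the companion family on a product space. Count coordinates carry the law of
  \<open>real (P n)\<close> copied from the given space, and rounding them back to naturals
  transfers the Poisson law without recomputing it.\<close>

lemma (in compound_poisson) same_rates_other_jumps:
  assumes nu: "real_distribution \<nu>" "integrable \<nu> (\<lambda>x. x\<^sup>2)"
  obtains B :: "(rv_idx \<Rightarrow> real) measure" and X' Y' P' where "compound_poisson B X' Y' P' \<nu> b"
proof -
  have nat_floor[measurable]: "(\<lambda>x::real. nat \<lfloor>x\<rfloor>) \<in> borel \<rightarrow>\<^sub>M count_space UNIV" by measurable
  have real_nat_floor: "(\<lambda>x::real. real (nat \<lfloor>x\<rfloor>)) \<in> borel_measurable borel" by measurable
  have real_P: "(\<lambda>\<omega>. real (P n \<omega>)) \<in> borel_measurable M" for n by measurable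
  define F where "F i = (case i of IP n \<Rightarrow> distr M borel (\<lambda>\<omega>. real (P n \<omega>)) | _ \<Rightarrow> \<nu>)" for i
  have F: "real_distribution (F i)" for i
  proof (cases i)
    case (IP n)
    show ?thesis using IP real_P by (simp add: F_def real_distribution_distr)
  qed (simp_all add: F_def nu)
  define B where "B = PiM UNIV F"
  note pr = product_real_distributions[of F, OF F, folded B_def]
  interpret B: prob_space B by (rule pr(1))
  have [measurable]: "(\<lambda>\<omega>. \<omega> i) \<in> borel_measurable B" for i
    using pr(2) by (simp add: B.indep_vars_def)
  define P' where "P' n \<omega> = nat \<lfloor>\<omega> (IP n)\<rfloor>" for n and \<omega> :: "rv_idx \<Rightarrow> real"
  have "compound_poisson B (\<lambda>\<omega>. \<omega> IX) (\<lambda>n k \<omega>. \<omega> (IY n k)) P' \<nu> b"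
  proof (intro compound_poisson.intro compound_poisson_axioms.intro B.prob_space_axioms)
    show "real_distribution \<nu>" "integrable \<nu> (\<lambda>x. x\<^sup>2)" by fact+
    show "distr B borel (\<lambda>\<omega>. \<omega> (IY n k)) = \<nu>" for n k by (simp add: pr(3) F_def)
    show "0 \<le> b" by (rule b_nonneg)
    show "distributed B (count_space UNIV) (P' n) (\<lambda>j. ennreal (poisson_mass (b * 2 ^ n) j))" for n
    proof -
      have "distr B (count_space UNIV) (P' n) = distr (distr B borel (\<lambda>\<omega>. \<omega> (IP n))) (count_space UNIV) (\<lambda>x. nat \<lfloor>x\<rfloor>)"
        by (subst distr_distr) (simp_all add: o_def P'_def[abs_def])
      also have "\<dots> = distr M (count_space UNIV) (P n)"
        unfolding pr(3) F_def by (simp, subst distr_distr) (simp_all add: o_def real_P)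
      finally have "distr B (count_space UNIV) (P' n) = distr M (count_space UNIV) (P n)" .
      moreover have "P' n \<in> B \<rightarrow>\<^sub>M count_space UNIV" unfolding P'_def[abs_def] by measurable
      ultimately show ?thesis using distributed_P[of n] by (simp add: distributed_def)
    qed
    show "B.indep_vars (\<lambda>_. borel) (rv_family (\<lambda>\<omega>. \<omega> IX) (\<lambda>n k \<omega>. \<omega> (IY n k)) P') rv_indices"
    proof -
      \<comment> \<open>Rounding the count coordinates makes them literally of the form
        \<open>real (P' n \<omega>)\<close> required by \<open>rv_family\<close>; applying it
        coordinatewise keeps independence.\<close>
      define \<Phi> :: "rv_idx \<Rightarrow> real \<Rightarrow> real" where
        "\<Phi> i = (case i of IP n \<Rightarrow> (\<lambda>x. real (nat \<lfloor>x\<rfloor>)) | _ \<Rightarrow> (\<lambda>x. x))" for i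
      have "B.indep_vars (\<lambda>_. borel) (\<lambda>i \<omega>. \<Phi> i (\<omega> i)) rv_indices"
        by (rule B.indep_vars_compose2[OF B.indep_vars_subset[OF pr(2)]])
           (auto simp: \<Phi>_def real_nat_floor split: rv_idx.splits)
      also have "(\<lambda>i \<omega>. \<Phi> i (\<omega> i)) = rv_family (\<lambda>\<omega>. \<omega> IX) (\<lambda>n k \<omega>. \<omega> (IY n k)) P'"
        by (auto simp: fun_eq_iff \<Phi>_def rv_family_def P'_def split: rv_idx.splits)
      finally show ?thesis .
    qed
  qed
  then show thesis using that by blast
qed

text \<open>The event of no jump from level N on has probability at most exp(- b 2^(N+n)) for every
  n, hence 0. This makes S strictly positive, so that dividing by sqrt S makes sense.\<close>

lemma (in compound_poisson) AE_some_jump: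
  assumes "0 < b"
  shows "AE \<omega> in M. \<exists>n\<ge>N. 0 < P n \<omega>"
proof -
  let ?E = "{\<omega> \<in> space M. \<forall>n\<ge>N. P n \<omega> = 0}"
  have [measurable]: "?E \<in> sets M" by measurable
  have le: "measure M ?E \<le> exp (- (b * 2 ^ (N + n)))" for n
  proof -
    have "measure M ?E \<le> measure M (P (N + n) -` {0} \<inter> space M)"
      by (rule finite_measure_mono) auto
    also have "\<dots> = expectation (\<lambda>\<omega>. indicator {0} (P (N + n) \<omega>))"
    proof -
      have "(\<lambda>\<omega>. indicator {0} (P (N + n) \<omega>) :: real) = indicator (P (N + n) -` {0})"
        by (auto simp: indicator_def)
      then show ?thesis by simp
    qed
    also have "\<dots> = exp (- (b * 2 ^ (N + n)))"
      unfolding expectation_indicator_P by (simp add: poisson_mass_def rate_def)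
    finally show ?thesis .
  qed
  have "(\<lambda>n. exp (- (b * 2 ^ (N + n)))) \<longlonglongrightarrow> 0" using assms by real_asymp
  then have "measure M ?E \<le> 0" by (rule LIMSEQ_le_const) (use le in auto)
  then have "emeasure M ?E = 0" using measure_nonneg[of M ?E] by (simp add: emeasure_eq_measure)
  then have "AE \<omega> in M. \<omega> \<notin> ?E" by (intro AE_not_in null_setsI) auto
  then show ?thesis using AE_space by eventually_elim auto
qed

text \<open>\<open>\<mu>\<close> is the law of S, realised on the companion space with the same
  Poisson intensities. The transforms of T and S agree level by level: the characteristic function
  of a jump at t 2^-k is the Laplace transform of \<open>\<nu>\<close> at (t^2/2) 4^-k. The ratio
  1/8 in the variance is 2 r^2 for r = 1/4.\<close>

lemma (in compound_poisson) tail_law_gauss_mixture: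
  assumes nu: "real_distribution \<nu>" "AE s in \<nu>. 0 < s" "integrable \<nu> (\<lambda>s. s\<^sup>2)"
    and D_eq: "D = gauss_mixture \<nu>" and b: "0 < b"
  obtains \<mu> where "real_distribution \<mu>" "AE s in \<mu>. 0 < s"
    "distr M borel (tail (1/2) N) = gauss_mixture \<mu>"
    "integrable \<mu> (\<lambda>s. (s - b * (\<integral>s. s \<partial>\<nu>) * (1/2) ^ N)\<^sup>2)"
    "(\<integral>s. (s - b * (\<integral>s. s \<partial>\<nu>) * (1/2) ^ N)\<^sup>2 \<partial>\<mu>) = b * (\<integral>s. s\<^sup>2 \<partial>\<nu>) * (1/8) ^ (N + 1) / (7/8)"
proof -
  obtain B :: "(rv_idx \<Rightarrow> real) measure" and X' Y' P' where cp: "compound_poisson B X' Y' P' \<nu> b"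
    using same_rates_other_jumps[OF nu(1,3)] .
  interpret V: compound_poisson B X' Y' P' \<nu> b by (rule cp)
  have nu_nn: "AE s in \<nu>. 0 \<le> s" using nu(2) by (auto elim!: eventually_mono)
  have mean0: "mean = 0"
    unfolding D_eq by (rule gauss_mixture_moments(3)[OF nu(1) nu_nn V.integrable_D_id])
  define S where "S = V.tail (1/4) N"
  \<comment> \<open>The mean of S: the sum over n > N of 4^-n (b 2^n) E V is a geometric series of
    ratio 1/2 whose total is 2^-N times b E V.\<close>
  define m where "m = b * (\<integral>s. s \<partial>\<nu>) * (1/2) ^ N"
  have [measurable]: "S \<in> borel_measurable B" by (simp add: S_def)
  have "(\<lambda>n. b * (\<integral>s. s \<partial>\<nu>) * (1/2) ^ (N + 1) * (1/2) ^ n) sums (b * (\<integral>s. s \<partial>\<nu>) * (1/2) ^ (N + 1) * (1 / (1 - 1/2)))"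
    by (intro sums_mult geometric_sums) simp
  moreover have "(1/4) ^ (N + 1 + n) * (V.rate (N + 1 + n) * (\<integral>s. s \<partial>\<nu>)) = b * (\<integral>s. s \<partial>\<nu>) * (1/2) ^ (N + 1) * (1/2) ^ n" for n
  proof -
    have "(1/4 :: real) ^ k * 2 ^ k = (1/2) ^ k" for k by (simp add: power_mult_distrib[symmetric])
    then have key: "(1/4) ^ k * (b * 2 ^ k * (\<integral>s. s \<partial>\<nu>)) = b * (\<integral>s. s \<partial>\<nu>) * (1/2) ^ k" for k
      by (metis (no_types, lifting) mult.commute mult.left_commute)
    then show ?thesis unfolding V.rate_def by (subst key) (simp add: power_add)
  qed
  ultimately have sums: "(\<lambda>n. (1/4) ^ (N + 1 + n) * (V.rate (N + 1 + n) * (\<integral>s. s \<partial>\<nu>))) sums m"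
    by (simp only: m_def) simp
  note L2S = V.tail_L2[OF _ _ sums, folded S_def]
  have AE_S: "AE \<omega> in B. summable (\<lambda>n. (1/4) ^ (N + 1 + n) * V.jump_sum (N + 1 + n) \<omega>)" by (rule L2S(1)) auto
  have L2T: "AE \<omega> in M. summable (\<lambda>n. (1/2) ^ (N + 1 + n) * jump_sum (N + 1 + n) \<omega>)"
    by (rule tail_L2(1)[where \<mu>=0]) (simp_all add: mean0)
  define \<mu> where "\<mu> = distr B borel S"
  have mu: "real_distribution \<mu>" unfolding \<mu>_def by (rule V.real_distribution_distr) simp
  \<comment> \<open>All jumps are positive, so every term is nonnegative, and any level beyond N
    with at least one jump contributes a positive term.\<close>
  have S_pos: "AE \<omega> in B. 0 < S \<omega>"
    using AE_S V.AE_Y[OF nu(2)] V.AE_some_jump[OF b, of "N + 1"]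
  proof eventually_elim
    case (elim \<omega>)
    obtain n where n: "0 < P' (N + 1 + n) \<omega>"
      using elim(3) by (metis le_Suc_ex)
    have pos: "0 < V.jump_sum k \<omega> \<longleftrightarrow> 0 < P' k \<omega>" "0 \<le> V.jump_sum k \<omega>" for k
      using elim(2) by (cases "P' k \<omega> = 0"; auto simp: V.jump_sum_def intro!: sum_pos sum_nonneg less_imp_le)+
    show "0 < S \<omega>" unfolding S_def V.tail_def
      by (rule suminf_pos2[OF elim(1), of n]) (use pos n in auto)
  qed
  then have mu_pos: "AE s in \<mu>. 0 < s" unfolding \<mu>_def by (subst AE_distr_iff) auto
  have "distr M borel (tail (1/2) N) = gauss_mixture \<mu>"
  proof (rule Levy_uniqueness[OF _ real_distribution_gauss_mixture[OF mu]], goal_cases)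
    case 1
    show ?case by (rule real_distribution_distr) simp
  next
    case 2
    show ?case
    proof
      fix t
      let ?z = "\<i> * complex_of_real t" and ?u = "complex_of_real (- (t\<^sup>2 / 2))"
      have "char (gauss_mixture \<mu>) t = (\<integral>s. exp (of_real (- (t\<^sup>2 * s / 2))) \<partial>\<mu>)"
        by (rule char_gauss_mixture[OF mu]) (use mu_pos in \<open>auto elim!: eventually_mono\<close>)
      also have "\<dots> = (\<integral>\<omega>. exp (of_real (- (t\<^sup>2 * S \<omega> / 2))) \<partial>B)"
        unfolding \<mu>_def by (subst integral_distr) auto
      also have "\<dots> = V.expectation (\<lambda>\<omega>. exp (?u * of_real (V.tail (1/4) N \<omega>)))"
        by (simp add: S_def)
      finally have 1: "char (gauss_mixture \<mu>) t = V.expectation (\<lambda>\<omega>. exp (?u * of_real (V.tail (1/4) N \<omega>)))" .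
      have 2: "char (distr M borel (tail (1/2) N)) t = expectation (\<lambda>\<omega>. exp (?z * of_real (tail (1/2) N \<omega>)))"
        unfolding char_def by (subst integral_distr) (simp_all add: mult.assoc)
      have lim1: "(\<lambda>k. \<Prod>n<k. exp (of_real (V.rate (N + 1 + n)) * ((\<integral>x. exp (?u * of_real ((1/4) ^ (N + 1 + n)) * of_real x) \<partial>\<nu>) - 1)))
        \<longlonglongrightarrow> char (gauss_mixture \<mu>) t"
        unfolding 1
      proof (rule V.expectation_exp_tail[OF _ _ AE_S])
        show "AE x in \<nu>. Re ?u * x \<le> 0" using nu_nn by eventually_elim simp
      qed simp
      have lim2: "(\<lambda>k. \<Prod>n<k. exp (of_real (rate (N + 1 + n)) * ((\<integral>x. exp (?z * of_real ((1/2) ^ (N + 1 + n)) * of_real x) \<partial>D) - 1)))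
        \<longlonglongrightarrow> char (distr M borel (tail (1/2) N)) t"
        unfolding 2 by (rule expectation_exp_tail[OF _ _ L2T]) simp_all
      have "(\<integral>x. exp (?z * of_real ((1/2) ^ k) * of_real x) \<partial>D) = (\<integral>x. exp (?u * of_real ((1/4) ^ k) * of_real x) \<partial>\<nu>)" for k
      proof -
        have "(\<integral>x. exp (?z * of_real ((1/2) ^ k) * of_real x) \<partial>D) = char D (t * (1/2) ^ k)"
          unfolding char_def by (simp add: mult.assoc)
        also have "\<dots> = (\<integral>s. exp (of_real (- ((t * (1/2) ^ k)\<^sup>2 * s / 2))) \<partial>\<nu>)"
          unfolding D_eq by (rule char_gauss_mixture[OF nu(1) nu_nn])
        also have "\<dots> = (\<integral>x. exp (?u * of_real ((1/4) ^ k) * of_real x) \<partial>\<nu>)"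
        proof -
          have "((1/2 :: real) ^ k)\<^sup>2 = (1/4) ^ k"
          proof -
            have "(1/4 :: real) ^ k = (1/2 * (1/2)) ^ k" by simp
            then show ?thesis by (simp only: power_mult_distrib power2_eq_square)
          qed
          then have "- ((t * (1/2) ^ k)\<^sup>2 * s / 2) = - (t\<^sup>2 / 2) * (1/4) ^ k * s" for s
            by (simp add: power_mult_distrib)
          then show ?thesis by (simp only: of_real_mult[symmetric])
        qed
        finally show ?thesis .
      qed
      then show "char (distr M borel (tail (1/2) N)) t = char (gauss_mixture \<mu>) t"
        using lim1 lim2 unfolding V.rate_def rate_def by (simp only:) (rule LIMSEQ_unique)
    qed
  qed
  moreover have "integrable B (\<lambda>\<omega>. (S \<omega> - m)\<^sup>2)" by (rule L2S(2)) auto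
  moreover have "(\<integral>\<omega>. (S \<omega> - m)\<^sup>2 \<partial>B) = b * (\<integral>s. s\<^sup>2 \<partial>\<nu>) * (1/8) ^ (N + 1) / (7/8)"
    using L2S(3) by (simp add: power2_eq_square)
  ultimately show thesis
    using that[OF mu mu_pos] unfolding \<mu>_def m_def by (simp add: integrable_distr_eq integral_distr)
qed

section \<open>The square-root estimate and the extension for a = 0\<close>

lemma distributed_lborel_distr: "distributed M lborel X (\<lambda>x. ennreal (f x)) \<Longrightarrow> distr M borel X = density lborel (\<lambda>x. ennreal (f x))"
  unfolding distributed_def by (metis distr_cong sets_lborel)

text \<open>(s - m)^2 = (sqrt s - sqrt m)^2 (sqrt s + sqrt m)^2, and the second factor is at least
  m.\<close>

lemma square_sqrt_diff_le:
  fixes s m :: real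
  assumes "0 \<le> s" "0 < m"
  shows "(sqrt s - sqrt m)\<^sup>2 \<le> (s - m)\<^sup>2 / m"
proof -
  have "(sqrt s - sqrt m)\<^sup>2 * m \<le> (sqrt s - sqrt m)\<^sup>2 * (sqrt s + sqrt m)\<^sup>2"
  proof (rule mult_left_mono)
    have "(sqrt m)\<^sup>2 \<le> (sqrt s + sqrt m)\<^sup>2" using assms by (intro power_mono) auto
    then show "m \<le> (sqrt s + sqrt m)\<^sup>2" using assms by simp
  qed simp
  also have "\<dots> = (s - m)\<^sup>2"
    using assms by (simp add: power_mult_distrib[symmetric] algebra_simps)
  finally show ?thesis using assms by (simp add: field_simps)
qed

text \<open>Serves a = 0, where \<open>\<sigma>_N\<close> vanishes and any normal variable
  independent of A_N(h) will do.\<close>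

lemma independent_normal_extension:
  fixes M :: "'a measure" and A :: "'a \<Rightarrow> real"
  assumes M: "prob_space M" and [measurable]: "A \<in> borel_measurable M"
  defines "M' \<equiv> M \<Otimes>\<^sub>M std_normal_distribution"
  shows "prob_space M'" "distr M' M fst = M"
    "distributed M' lborel snd (\<lambda>x. ennreal (std_normal_density x))"
    "prob_space.indep_var M' borel snd borel (\<lambda>x. A (fst x))"
proof -
  interpret M: prob_space M by fact
  interpret N: real_distribution std_normal_distribution by (rule real_dist_normal_dist)
  interpret P: pair_prob_space M std_normal_distribution ..
  interpret Q: pair_prob_space std_normal_distribution "distr M borel A"
    by (intro pair_prob_space.intro pair_sigma_finite.intro prob_space_imp_sigma_finite M.prob_space_distr N.prob_space_axioms assms(2))
  show "prob_space M'" unfolding M'_def by (rule P.prob_space_axioms)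
  show proj: "distr M' M fst = M" unfolding M'_def by (rule N.distr_pair_fst)
  have "distr (M \<Otimes>\<^sub>M std_normal_distribution) std_normal_distribution snd = std_normal_distribution"
  proof (rule measure_eqI)
    fix B assume "B \<in> sets (distr (M \<Otimes>\<^sub>M std_normal_distribution) std_normal_distribution snd)"
    then have B: "B \<in> sets std_normal_distribution" by simp
    have "snd -` B \<inter> space (M \<Otimes>\<^sub>M std_normal_distribution) = space M \<times> B"
      using sets.sets_into_space[OF B] by (auto simp: space_pair_measure)
    then show "emeasure (distr (M \<Otimes>\<^sub>M std_normal_distribution) std_normal_distribution snd) B = emeasure std_normal_distribution B"
      using B by (simp add: emeasure_distr N.emeasure_pair_measure_Times M.emeasure_space_1)
  qed simp
  then have Z: "distr M' borel snd = std_normal_distribution"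
    unfolding M'_def by (simp cong: distr_cong)
  then show "distributed M' lborel snd (\<lambda>x. ennreal (std_normal_density x))"
    unfolding distributed_def M'_def by (auto cong: distr_cong)
  have A_law: "distr M' borel (\<lambda>x. A (fst x)) = distr M borel A"
    using distr_distr[of A M borel fst M'] proj by (simp add: o_def M'_def)
  have "std_normal_distribution \<Otimes>\<^sub>M distr M borel A = distr M' (borel \<Otimes>\<^sub>M borel) (\<lambda>p. (snd p, A (fst p)))"
  proof (rule measure_eqI)
    show sets_eq: "sets (std_normal_distribution \<Otimes>\<^sub>M distr M borel A) = sets (distr M' (borel \<Otimes>\<^sub>M borel) (\<lambda>p. (snd p, A (fst p))))"
      by (simp add: sets_pair_measure_cong[of std_normal_distribution borel "distr M borel A" borel])
    fix B assume B[measurable]: "B \<in> sets (std_normal_distribution \<Otimes>\<^sub>M distr M borel A)"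
    then have [measurable]: "B \<in> sets (borel \<Otimes>\<^sub>M borel)" unfolding sets_eq by simp
    have "emeasure (std_normal_distribution \<Otimes>\<^sub>M distr M borel A) B
       = (\<integral>\<^sup>+p. indicator B p \<partial>(std_normal_distribution \<Otimes>\<^sub>M distr M borel A))" by simp
    also have "\<dots> = (\<integral>\<^sup>+x. \<integral>\<^sup>+z. indicator B (z, x) \<partial>std_normal_distribution \<partial>distr M borel A)"
      by (subst Q.nn_integral_snd[symmetric]) simp_all
    also have "\<dots> = (\<integral>\<^sup>+\<omega>. \<integral>\<^sup>+z. indicator B (z, A \<omega>) \<partial>std_normal_distribution \<partial>M)"
      by (subst nn_integral_distr) simp_all
    also have "\<dots> = (\<integral>\<^sup>+p. indicator B (snd p, A (fst p)) \<partial>M')"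
      unfolding M'_def by (subst N.nn_integral_fst[symmetric]) simp_all
    also have "\<dots> = emeasure (distr M' (borel \<Otimes>\<^sub>M borel) (\<lambda>p. (snd p, A (fst p)))) B"
      unfolding M'_def by (subst nn_integral_indicator[symmetric], simp, subst nn_integral_distr) simp_all
    finally show "emeasure (std_normal_distribution \<Otimes>\<^sub>M distr M borel A) B
       = emeasure (distr M' (borel \<Otimes>\<^sub>M borel) (\<lambda>p. (snd p, A (fst p)))) B" .
  qed
  then show "prob_space.indep_var M' borel snd borel (\<lambda>x. A (fst x))"
    using Z A_law unfolding M'_def P.indep_var_distribution_eq by simp
qed

section \<open>The truncated expansion\<close>

theorem theorem2:
  fixes M :: "'a measure"
    and X :: "'a \<Rightarrow> real" and Y :: "nat \<Rightarrow> nat \<Rightarrow> 'a \<Rightarrow> real" and P :: "nat \<Rightarrow> 'a \<Rightarrow> nat"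
    and h a :: real and N :: nat
  assumes "prob_space M"
    and "h > 0" and "a \<ge> 0"
    and "distributed M lborel X (\<lambda>x. ennreal (logistic_density x))"
    and "\<And>n k. k \<ge> 1 \<Longrightarrow> distributed M lborel (Y n k) (\<lambda>x. ennreal (logistic_density x))"
    and "\<And>n. distributed M (count_space UNIV) (P n)
               (\<lambda>j. ennreal (poisson_mass (a^2 * 2^n / 2) j))"
    and "prob_space.indep_vars M (\<lambda>_. borel)
           (\<lambda>i. case i of IX \<Rightarrow> X | IY n k \<Rightarrow> Y n k | IP n \<Rightarrow> (\<lambda>\<omega>. real (P n \<omega>)))
           ({IX} \<union> {IY n k | n k. k \<ge> 1} \<union> range IP)"
  shows "integrable M (\<lambda>\<omega>. (levy_A h X Y P \<omega> - levy_A_N h N X Y P \<omega>)^2)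
       \<and> prob_space.expectation M (\<lambda>\<omega>. (levy_A h X Y P \<omega> - levy_A_N h N X Y P \<omega>)^2)
           = a^2 / (3 * 2^(N+1)) * (h/2)^2
       \<and> (\<exists>(M' :: ('a \<times> real) measure) \<pi> Z.
            prob_space M' \<and> \<pi> \<in> measurable M' M \<and> distr M' M \<pi> = M
          \<and> distributed M' lborel Z (\<lambda>x. ennreal (std_normal_density x))
          \<and> prob_space.indep_var M' borel Z borel (\<lambda>\<omega>. levy_A_N h N X Y P (\<pi> \<omega>))
          \<and> integrable M' (\<lambda>\<omega>. (levy_A h X Y P (\<pi> \<omega>)
                 - (levy_A_N h N X Y P (\<pi> \<omega>) + a / sqrt (3 * 2^(N+1)) * (h/2) * Z \<omega>))^2)
          \<and> prob_space.expectation M' (\<lambda>\<omega>. (levy_A h X Y P (\<pi> \<omega>)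
                 - (levy_A_N h N X Y P (\<pi> \<omega>) + a / sqrt (3 * 2^(N+1)) * (h/2) * Z \<omega>))^2)
              \<le> 8 / 15 * (1 / 2^(2*N+2)) * (h/2)^2)"
proof -
  interpret M: prob_space M by fact
  obtain \<nu> where nu: "real_distribution \<nu>" "AE s in \<nu>. 0 < s" "integrable \<nu> (\<lambda>s. s\<^sup>2)"
    and nu_mean: "(\<integral>s. s \<partial>\<nu>) = pi\<^sup>2 / 3" and nu_square: "(\<integral>s. s\<^sup>2 \<partial>\<nu>) \<le> 2 * (pi\<^sup>2 / 3)\<^sup>2"
    and logistic: "gauss_mixture \<nu> = logistic_distribution"
    by (rule logistic_is_gauss_mixture)
  interpret nu: real_distribution \<nu> by (rule nu)
  have nu_int: "integrable \<nu> (\<lambda>s. s)" by (rule nu.square_integrable_imp_integrable[OF _ nu(3)]) simp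
  have nu_nn: "AE s in \<nu>. 0 \<le> s" using nu(2) by (auto elim!: eventually_mono)
  note D_moments = gauss_mixture_moments[OF nu(1) nu_nn nu_int, unfolded logistic nu_mean]
  define b where "b = a\<^sup>2 / 2"
  define c where "c = h / (2 * pi)"
  have cp: "compound_poisson M X Y P logistic_distribution b"
  proof (intro compound_poisson.intro compound_poisson_axioms.intro assms(1))
    show "real_distribution logistic_distribution" by (rule real_distribution_logistic)
    show "distr M borel (Y n k) = logistic_distribution" if "1 \<le> k" for n k
      using distributed_lborel_distr[OF assms(5)[OF that]] by (simp add: logistic_distribution_def)
    show "distributed M (count_space UNIV) (P n) (\<lambda>j. ennreal (poisson_mass (b * 2 ^ n) j))" for n
      using assms(6)[of n] by (simp add: b_def)
    show "M.indep_vars (\<lambda>_. borel) (rv_family X Y P) rv_indices"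
      using assms(7) unfolding rv_family_def rv_indices_def .
  qed (simp_all add: D_moments b_def)
  interpret C: compound_poisson M X Y P logistic_distribution b by (rule cp)
  define T where "T = C.tail (1/2) N"
  have [measurable]: "T \<in> borel_measurable M" by (simp add: T_def)
  have A_eq: "levy_A h X Y P = (\<lambda>\<omega>. c * (X \<omega> + (\<Sum>n. 1 / 2 ^ n * C.jump_sum n \<omega>)))"
    by (simp add: fun_eq_iff levy_A_def c_def C.jump_sum_def)
  have AN_eq: "levy_A_N h N X Y P = (\<lambda>\<omega>. c * (X \<omega> + (\<Sum>n = 0..N. 1 / 2 ^ n * C.jump_sum n \<omega>)))"
    by (simp add: fun_eq_iff levy_A_N_def c_def C.jump_sum_def)
  have [measurable]: "levy_A h X Y P \<in> borel_measurable M" unfolding A_eq by measurable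
  have [measurable]: "levy_A_N h N X Y P \<in> borel_measurable M" unfolding AN_eq by measurable
  note L2 = C.tail_L2[of "1/2" N 0, folded T_def]
  have zero: "(\<lambda>n. (1/2) ^ (N + 1 + n) * (C.rate (N + 1 + n) * (\<integral>x. x \<partial>logistic_distribution))) sums 0"
    by (simp add: D_moments)
  \<comment> \<open>Only almost everywhere: on divergent paths \<open>suminf\<close> is a default
    value and cannot be split at N + 1.\<close>
  have diff: "AE \<omega> in M. levy_A h X Y P \<omega> - levy_A_N h N X Y P \<omega> = c * T \<omega>"
    using L2(1)[OF _ _ zero, simplified]
  proof eventually_elim
    case (elim \<omega>)
    let ?f = "\<lambda>n. 1 / 2 ^ n * C.jump_sum n \<omega>"
    have eq: "(1/2) ^ (N + 1 + n) * C.jump_sum (N + 1 + n) \<omega> = ?f (n + (N + 1))" for n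
      by (simp add: power_one_over add.commute)
    have "summable (\<lambda>n. ?f (n + (N + 1)))"
      using elim unfolding eq[symmetric] by simp
    then have "summable ?f" by (rule summable_iff_shift[THEN iffD1])
    from suminf_split_initial_segment[OF this, of "N + 1"]
    have "suminf ?f = T \<omega> + (\<Sum>n<N + 1. ?f n)"
      unfolding T_def C.tail_def eq .
    also have "{..<N + 1} = {0..N}" by auto
    finally show ?case unfolding A_eq AN_eq by (simp add: algebra_simps)
  qed
  have T2: "integrable M (\<lambda>\<omega>. (T \<omega>)\<^sup>2)" using L2(2)[OF _ _ zero] by simp
  have ET2: "M.expectation (\<lambda>\<omega>. (T \<omega>)\<^sup>2) = a\<^sup>2 * pi\<^sup>2 / (3 * 2 ^ (N + 1))"
  proof -
    have half: "2 * (1/2)\<^sup>2 = (1/2 :: real)" by (simp add: power2_eq_square)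
    have "M.expectation (\<lambda>\<omega>. (T \<omega>)\<^sup>2) = b * (pi\<^sup>2 / 3) * (1/2) ^ (N + 1) / (1 - 1/2)"
      using L2(3)[OF _ _ zero] unfolding half D_moments(2) by simp
    then show ?thesis by (simp add: b_def power_one_over)
  qed
  have int: "integrable M (\<lambda>\<omega>. (levy_A h X Y P \<omega> - levy_A_N h N X Y P \<omega>)^2)"
  proof (rule integrable_cong_AE_imp)
    show "integrable M (\<lambda>\<omega>. c\<^sup>2 * (T \<omega>)\<^sup>2)" using T2 by simp
    show "AE \<omega> in M. c\<^sup>2 * (T \<omega>)\<^sup>2 = (levy_A h X Y P \<omega> - levy_A_N h N X Y P \<omega>)^2"
      using diff by eventually_elim (simp add: power_mult_distrib)
  qed measurable
  have "M.expectation (\<lambda>\<omega>. (levy_A h X Y P \<omega> - levy_A_N h N X Y P \<omega>)^2) = M.expectation (\<lambda>\<omega>. c\<^sup>2 * (T \<omega>)\<^sup>2)"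
  proof (rule integral_cong_AE)
    show "AE \<omega> in M. (levy_A h X Y P \<omega> - levy_A_N h N X Y P \<omega>)^2 = c\<^sup>2 * (T \<omega>)\<^sup>2"
      using diff by eventually_elim (simp add: power_mult_distrib)
  qed measurable
  also have "\<dots> = c\<^sup>2 * (a\<^sup>2 * pi\<^sup>2 / (3 * 2 ^ (N + 1)))" by (simp only: integral_mult_right_zero ET2)
  also have "\<dots> = a^2 / (3 * 2^(N+1)) * (h/2)^2"
    by (simp add: c_def power_divide power_mult_distrib)
  finally have E: "M.expectation (\<lambda>\<omega>. (levy_A h X Y P \<omega> - levy_A_N h N X Y P \<omega>)^2) = a^2 / (3 * 2^(N+1)) * (h/2)^2" .
  define \<sigma> where "\<sigma> = a / sqrt (3 * 2^(N+1)) * (h/2)"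
  have "\<exists>(M' :: ('a \<times> real) measure) \<pi> Z.
            prob_space M' \<and> \<pi> \<in> measurable M' M \<and> distr M' M \<pi> = M
          \<and> distributed M' lborel Z (\<lambda>x. ennreal (std_normal_density x))
          \<and> prob_space.indep_var M' borel Z borel (\<lambda>\<omega>. levy_A_N h N X Y P (\<pi> \<omega>))
          \<and> integrable M' (\<lambda>\<omega>. (levy_A h X Y P (\<pi> \<omega>) - (levy_A_N h N X Y P (\<pi> \<omega>) + \<sigma> * Z \<omega>))^2)
          \<and> prob_space.expectation M' (\<lambda>\<omega>. (levy_A h X Y P (\<pi> \<omega>) - (levy_A_N h N X Y P (\<pi> \<omega>) + \<sigma> * Z \<omega>))^2)
              \<le> 8 / 15 * (1 / 2^(2*N+2)) * (h/2)^2"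
  \<comment> \<open>For a = 0 both A(h) - A_N(h) and S vanish almost surely, and T / sqrt S would
    not be normal.\<close>
  proof (cases "a = 0")
    case True
    then have \<sigma>0: "\<sigma> = 0" by (simp add: \<sigma>_def)
    define M' where "M' = M \<Otimes>\<^sub>M std_normal_distribution"
    have "levy_A_N h N X Y P \<in> borel_measurable M" by measurable
    note ext = independent_normal_extension[OF assms(1) this, folded M'_def]
    have [measurable]: "fst \<in> M' \<rightarrow>\<^sub>M M" by (simp add: M'_def)
    have "integrable (distr M' M fst) (\<lambda>\<omega>. (levy_A h X Y P \<omega> - levy_A_N h N X Y P \<omega>)^2)"
      unfolding ext(2) by (rule int)
    then have i: "integrable M' (\<lambda>\<omega>. (levy_A h X Y P (fst \<omega>) - levy_A_N h N X Y P (fst \<omega>))^2)"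
      by (subst (asm) integrable_distr_eq) simp_all
    have "(\<integral>\<omega>. (levy_A h X Y P \<omega> - levy_A_N h N X Y P \<omega>)^2 \<partial>distr M' M fst) = 0"
      unfolding ext(2) E using True by simp
    then have "(\<integral>\<omega>. (levy_A h X Y P (fst \<omega>) - levy_A_N h N X Y P (fst \<omega>))^2 \<partial>M') = 0"
      by (subst (asm) integral_distr) simp_all
    with i ext show ?thesis
      by (intro exI[of _ M'] exI[of _ fst] exI[of _ snd]) (simp add: \<sigma>0)
  next
    case False
    then have b: "0 < b" by (simp add: b_def)
    obtain \<mu> where mu: "real_distribution \<mu>" "AE s in \<mu>. 0 < s" "distr M borel T = gauss_mixture \<mu>"
      and dev: "integrable \<mu> (\<lambda>s. (s - b * (\<integral>s. s \<partial>\<nu>) * (1/2) ^ N)\<^sup>2)"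
        "(\<integral>s. (s - b * (\<integral>s. s \<partial>\<nu>) * (1/2) ^ N)\<^sup>2 \<partial>\<mu>) = b * (\<integral>s. s\<^sup>2 \<partial>\<nu>) * (1/8) ^ (N + 1) / (7/8)"
      using C.tail_law_gauss_mixture[OF nu logistic[symmetric] b, of N] unfolding T_def by metis
    interpret mu: real_distribution \<mu> by (rule mu)
    interpret N: real_distribution std_normal_distribution by (rule real_dist_normal_dist)
    define m where "m = b * (\<integral>s. s \<partial>\<nu>) * (1/2) ^ N"
    have m: "0 < m" using b by (simp add: m_def nu_mean)
    \<comment> \<open>The prescribed scale is the standard deviation of c T, since m = E T^2; this
      matches it with the centre m used for S.\<close>
    have \<sigma>_eq: "\<sigma> = c * sqrt m"
    proof -
      have "m = (a * pi)\<^sup>2 / (3 * 2 ^ (N + 1))"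
        by (simp add: m_def b_def nu_mean power_one_over power_mult_distrib)
      then have "sqrt m = a * pi / sqrt (3 * 2 ^ (N + 1))"
        using assms(3) by (simp add: real_sqrt_divide)
      then show ?thesis by (simp add: \<sigma>_def c_def mult.commute)
    qed
    have ind: "M.indep_var borel T borel (levy_A_N h N X Y P)"
      unfolding T_def AN_eq by (rule C.indep_tail)
    obtain M' :: "('a \<times> real) measure" and Z where ext:
      "prob_space M'" "fst \<in> M' \<rightarrow>\<^sub>M M" "distr M' M fst = M"
      "distributed M' lborel Z (\<lambda>x. ennreal (std_normal_density x))"
      "prob_space.indep_var M' borel Z borel (\<lambda>x. levy_A_N h N X Y P (fst x))"
      "\<And>H. H \<in> borel_measurable (borel \<Otimes>\<^sub>M borel) \<Longrightarrow>
        (\<integral>\<^sup>+x. H (T (fst x), Z x) \<partial>M') = (\<integral>\<^sup>+s. \<integral>\<^sup>+z. H (sqrt s * z, z) \<partial>std_normal_distribution \<partial>\<mu>)"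
      by (rule gauss_mixture_extension[OF assms(1) ind mu]) (rule that; assumption)
    note ext(2)[measurable]
    have [measurable]: "Z \<in> borel_measurable M'" using ext(4) by (simp add: distributed_def)
    let ?e = "\<lambda>\<omega>. (levy_A h X Y P (fst \<omega>) - (levy_A_N h N X Y P (fst \<omega>) + \<sigma> * Z \<omega>))\<^sup>2"
    let ?bound = "8 / 15 * (1 / 2^(2*N+2)) * (h/2)^2"
    have diff': "AE \<omega> in M'. levy_A h X Y P (fst \<omega>) - levy_A_N h N X Y P (fst \<omega>) = c * T (fst \<omega>)"
      by (rule AE_distrD[OF ext(2)], unfold ext(3), rule diff)
    have "(\<integral>\<^sup>+\<omega>. ennreal (?e \<omega>) \<partial>M') = (\<integral>\<^sup>+\<omega>. ennreal ((c * T (fst \<omega>) - \<sigma> * Z \<omega>)\<^sup>2) \<partial>M')"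
    proof (rule nn_integral_cong_AE)
      show "AE \<omega> in M'. ennreal (?e \<omega>) = ennreal ((c * T (fst \<omega>) - \<sigma> * Z \<omega>)\<^sup>2)"
        using diff'
      proof eventually_elim
        case (elim \<omega>)
        then have "levy_A h X Y P (fst \<omega>) - (levy_A_N h N X Y P (fst \<omega>) + \<sigma> * Z \<omega>) = c * T (fst \<omega>) - \<sigma> * Z \<omega>"
          by linarith
        then show ?case by (simp only:)
      qed
    qed
    also have "\<dots> = (\<integral>\<^sup>+s. \<integral>\<^sup>+z. ennreal ((c * (sqrt s * z) - \<sigma> * z)\<^sup>2) \<partial>std_normal_distribution \<partial>\<mu>)"
      using ext(6)[of "\<lambda>(t, z). ennreal ((c * t - \<sigma> * z)\<^sup>2)"] by simp
    \<comment> \<open>Given the scale s, the error is c (sqrt s - sqrt m) z, and E z^2 = 1.\<close>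
    also have "\<dots> = (\<integral>\<^sup>+s. ennreal (c\<^sup>2 * (sqrt s - sqrt m)\<^sup>2) \<partial>\<mu>)"
    proof (rule nn_integral_cong)
      fix s
      have "(\<integral>\<^sup>+z. ennreal ((c * (sqrt s * z) - \<sigma> * z)\<^sup>2) \<partial>std_normal_distribution)
        = (\<integral>\<^sup>+z. ennreal (c\<^sup>2 * (sqrt s - sqrt m)\<^sup>2) * ennreal (z\<^sup>2) \<partial>std_normal_distribution)"
      proof (rule nn_integral_cong)
        fix z
        have "c * (sqrt s * z) - \<sigma> * z = c * (sqrt s - sqrt m) * z" by (simp add: \<sigma>_eq algebra_simps)
        then show "ennreal ((c * (sqrt s * z) - \<sigma> * z)\<^sup>2) = ennreal (c\<^sup>2 * (sqrt s - sqrt m)\<^sup>2) * ennreal (z\<^sup>2)"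
          by (simp add: power_mult_distrib ennreal_mult[symmetric])
      qed
      also have "\<dots> = ennreal (c\<^sup>2 * (sqrt s - sqrt m)\<^sup>2)"
        by (subst nn_integral_cmult) (simp_all add: std_normal_integrals)
      finally show "(\<integral>\<^sup>+z. ennreal ((c * (sqrt s * z) - \<sigma> * z)\<^sup>2) \<partial>std_normal_distribution)
        = ennreal (c\<^sup>2 * (sqrt s - sqrt m)\<^sup>2)" .
    qed
    also have "\<dots> \<le> (\<integral>\<^sup>+s. ennreal (c\<^sup>2 / m * (s - m)\<^sup>2) \<partial>\<mu>)"
    proof (rule nn_integral_mono_AE)
      show "AE s in \<mu>. ennreal (c\<^sup>2 * (sqrt s - sqrt m)\<^sup>2) \<le> ennreal (c\<^sup>2 / m * (s - m)\<^sup>2)"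
        using mu(2)
      proof eventually_elim
        case (elim s)
        from mult_left_mono[OF square_sqrt_diff_le[of s m], of "c\<^sup>2"] elim m
        show ?case by (intro ennreal_leI) simp
      qed
    qed
    also have "\<dots> = ennreal (c\<^sup>2 / m * (\<integral>s. (s - m)\<^sup>2 \<partial>\<mu>))"
    proof (subst nn_integral_eq_integral)
      show "integrable \<mu> (\<lambda>s. c\<^sup>2 / m * (s - m)\<^sup>2)" using dev(1) unfolding m_def[symmetric] by simp
      show "AE s in \<mu>. 0 \<le> c\<^sup>2 / m * (s - m)\<^sup>2" using m by simp
    qed simp
    also have "\<dots> \<le> ennreal ?bound"
    proof (rule ennreal_leI)
      have "(\<integral>s. (s - m)\<^sup>2 \<partial>\<mu>) = b * (\<integral>s. s\<^sup>2 \<partial>\<nu>) * (1/8) ^ (N + 1) / (7/8)"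
        using dev(2) unfolding m_def[symmetric] .
      also have "\<dots> \<le> b * (2 * (pi\<^sup>2 / 3)\<^sup>2) * (1/8) ^ (N + 1) / (7/8)"
        using b nu_square by (intro divide_right_mono mult_right_mono mult_left_mono) auto
      finally have "c\<^sup>2 / m * (\<integral>s. (s - m)\<^sup>2 \<partial>\<mu>) \<le> c\<^sup>2 / m * (b * (2 * (pi\<^sup>2 / 3)\<^sup>2) * (1/8) ^ (N + 1) / (7/8))"
        using m by (intro mult_left_mono) auto
      \<comment> \<open>The intensity b and the power 2^N cancel against m. What remains is c^2
        (pi^2/3) 2 (1/2) (8/7) 2^-(2N+2): the 2 comes from E V^2, the 8/7 from the geometric series
        of ratio 1/8, and c^2 pi^2 = (h/2)^2.\<close>
      also have "\<dots> = 8 / 21 * (1 / 2^(2*N+2)) * (h/2)^2"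
      proof -
        have p: "(1/8 :: real) ^ (N + 1) = (1/2) ^ N * (1 / 2 ^ (2*N+2)) / 2"
        proof -
          have "(8::real) ^ (N + 1) = 2 ^ N * 2 ^ (2*N+2) * 2"
            by (simp add: power_add power_mult power_mult_distrib[symmetric])
          then show ?thesis by (simp add: power_one_over)
        qed
        show ?thesis unfolding p m_def nu_mean c_def using b
          by (simp add: field_simps power2_eq_square)
      qed
      also have "\<dots> \<le> ?bound" by (intro mult_right_mono) auto
      finally show "c\<^sup>2 / m * (\<integral>s. (s - m)\<^sup>2 \<partial>\<mu>) \<le> ?bound" .
    qed
    finally have le: "(\<integral>\<^sup>+\<omega>. ennreal (?e \<omega>) \<partial>M') \<le> ennreal ?bound" .
    have "integrable M' ?e"
    proof (rule integrableI_nonneg)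
      show "(\<integral>\<^sup>+\<omega>. ennreal (?e \<omega>) \<partial>M') < \<infinity>"
        using le by (rule order.strict_trans1) simp
    qed simp_all
    moreover have "(\<integral>\<omega>. ?e \<omega> \<partial>M') \<le> ?bound"
    proof -
      have "(\<integral>\<omega>. ?e \<omega> \<partial>M') = enn2real (\<integral>\<^sup>+\<omega>. ennreal (?e \<omega>) \<partial>M')"
        by (rule integral_eq_nn_integral) simp_all
      also have "\<dots> \<le> enn2real (ennreal ?bound)" using le by (intro enn2real_mono) simp_all
      also have "\<dots> = ?bound" by (rule enn2real_ennreal) simp
      finally show ?thesis .
    qed
    ultimately show ?thesis using ext(1-5) by (intro exI[of _ M'] exI[of _ fst] exI[of _ Z]) blast
  qed
  with int E show ?thesis unfolding \<sigma>_def by blast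
qed

end
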